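(* Let $s\ge2$ be an integer. Then $\Pi^s_{\mathcal D}\cong\mathcal{J}(\mathcal{D}^s,V^s_{\mathcal D})$ as algebras.
   Context: Conventions: algebras are over $\mathbb{C}$; $\mathbb{N}$ contains $0$; a product of paths $pq$ means "first $p$, then $q$"; $e_x$ is the trivial path at $x$. A quiver with potential $(Q,W)$ is a quiver with a linear combination $W$ of cycles (cycles regarded up to cyclic permutation); its Jacobian algebra is $\mathcal{J}(Q,W)=\mathbb{C}Q/\langle\partial_\alpha W\mid\alpha\in Q_1\rangle$, where $\partial_\alpha(\alpha_1\cdots\alpha_l)=\sum_{\alpha_i=\alpha}\alpha_{i+1}\cdots\alpha_l\alpha_1\cdots\alpha_{i-1}$. Let $f_0=(-1,1,0)$, $f_1=(0,-1,1)$, $f_2=(1,0,-1)$, let $\omega(x_0,x_1,x_2)=(x_1,x_2,x_0)$, and write $u\sim v$ for triples if $v\in\{u,\omega(u),\omega^2(u)\}$. Let $\succ$ be the strict lexicographic order on $\mathbb{N}^3$, $\zeta=e^{2\pi i/3}$; indices of arrows are taken mod 3. Type D quiver and potential $W^s_{\mathcal D}$. Let $Q_0=\{x\in\mathbb{N}^3\mid x_0+x_1+x_2=s-1,\ x\succ\omega(x),\ x\succ\omega^2(x)\}$ and let $Q_1$ consist of an arrow $e_x\alpha_{i,j}\colon x\to\omega^j(x)+f_i$ for all $i,j\in\{0,1,2\}$ and $x\in Q_0$ with $\omega^j(x)+f_i\in Q_0$; write $\alpha_i=\alpha_{i,0}$. If $s\not\equiv1\pmod 3$, $\mathcal{D}^s=(Q_0,Q_1)$.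 If $s=3t+1$ with $t\in\mathbb{Z}^+$, let $X=(t,t,t)$; then $\mathcal{D}^s$ has vertices $Q_0\cup\{X_0,X_1,X_2\}$ (three copies of $X$) and arrows $Q_1\cup\{\beta_k\colon X-f_0\to X_k,\ \gamma_k\colon X_k\to X+f_2\mid k=0,1,2\}$. $W^s_{\mathcal D}=\sum_c\lambda_{\mathcal D}(c)c$ over all 3-cycles $c$ of $\mathcal{D}^s$ (up to rotation), where: (1) if $c=e_x\alpha_{i_0,j_0}\alpha_{i_1,j_1}\alpha_{i_2,j_2}$ is a product of three distinct arrows and $j_0+j_1+j_2\equiv0$ (mod 3), then $\lambda_{\mathcal D}(c)=1$ if $(i_0+j_0,i_1-j_2,i_2)\sim(0,1,2)$ and $-1$ if it is $\sim(0,2,1)$; if $j_0+j_1+j_2\not\equiv0$ then $\lambda_{\mathcal D}(c)=0$; (2) if $c=e_x\alpha_{i,j}^3$ for a loop $e_x\alpha_{i,j}$, then $\lambda_{\mathcal D}(c)=\frac13$ if $(i+j,i-j,i)\sim(0,1,2)$ and $-\frac13$ if it is $\sim(0,2,1)$; (3) if $s\equiv1\pmod 3$, then for $k=0,1,2$, $\lambda_{\mathcal D}(\alpha_1\beta_k\gamma_k)=-1$ and $\lambda_{\mathcal D}(\alpha_{2,1}\beta_k\gamma_k)=\zeta^k$. Put $\Pi^s_{\mathcal D}=\mathcal{J}(\mathcal{D}^s,W^s_{\mathcal D})$. Coefficients $\mu_{\mathcal A}$. Let $q=e^{\pi i/(s+2)}$ and $[n]=(q^n-q^{-n})/(q-q^{-1})$.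 Let $\mathcal{A}^s$ be the quiver with vertices $\{x\in\mathbb{N}^3\mid x_0+x_1+x_2=s-1\}$ and an arrow $e_x\alpha_i\colon x\to x+f_i$ whenever both ends are vertices. For 3-cycles of $\mathcal{A}^s$ (up to rotation) set $$\mu_{\mathcal A}(e_x\alpha_0\alpha_1\alpha_2)=\sqrt{[x_1+1][x_1+2][x_2+1][x_2+2][x_1+x_2+2][x_1+x_2+3]}/[2],$$ $$\mu_{\mathcal A}(e_x\alpha_0\alpha_2\alpha_1)=\sqrt{[x_1+1][x_1+2][x_2][x_2+1][x_1+x_2+2][x_1+x_2+3]}/[2].$$ The potential $V^s_{\mathcal D}=\sum_c\mu_{\mathcal D}(c)c$ is the sum over all 3-cycles in $\mathcal{D}^s$ (up to rotation), where: (a) if $s=3t+1$ with $t\in\mathbb{Z}^+$, then for $k=0,1,2$ $$\mu_{\mathcal D}(\alpha_1\beta_k\gamma_k)=\zeta^k\frac{[t]\sqrt{[t+1]^3[t+2]}}{\sqrt3\,[2]},\qquad \mu_{\mathcal D}(\alpha_{2,1}\beta_k\gamma_k)=\zeta^{-k}\frac{[t+2]\sqrt{[t][t+1]^3}}{\sqrt3\,[2]};$$ (b) for every other 3-cycle $c=e_x\alpha_{i_0,j_0}\alpha_{i_1,j_1}\alpha_{i_2,j_2}$ (for any $s$), $\mu_{\mathcal D}(c)=\widetilde{\mu_{\mathcal A}}(c)$, where $\widetilde{\mu_{\mathcal A}}(c)=0$ if $j_0+j_1+j_2\not\equiv0\pmod3$, and otherwise $\widetilde{\mu_{\mathcal A}}(c)=\mu_{\mathcal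 A}(d)\,|\mathbb{Z}_3\cdot d|/3$ with $d=e_x\alpha_{i_0+j_0}\alpha_{i_1-j_2}\alpha_{i_2}$ the corresponding 3-cycle of $\mathcal{A}^s$ and $\mathbb{Z}_3\cdot d$ its orbit (cycles up to rotation) under the automorphism $e_x\alpha_i\mapsto e_{\omega(x)}\alpha_{i-1}$ of $\mathcal{A}^s$; thus $|\mathbb{Z}_3\cdot d|/3$ equals $1$ if $c$ is a product of three distinct arrows and $\frac13$ if $c$ is the cube of a loop. *)

theory Defs
  imports
    Complex_Main
    "HOL-Library.Poly_Mapping"
    "HOL-Library.Product_Plus"
    "HOL-Algebra.Module"
    "HOL-Algebra.QuotRing"
    "Graph_Theory.Arc_Walk"
begin

section \<open>Path algebras\<close>

text \<open>
  A quiver is a \<^typ>\<open>('v, 'a) pre_digraph\<close> (loops and parallel arcs are allowed).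
  A path is a pair of its start vertex and its list of arrows, so that \<open>(v, [])\<close> is the
  trivial path at \<open>v\<close>; the product of paths is concatenation, first factor first.
\<close>

type_synonym ('v, 'a) qpath = "'v \<times> 'a list"

definition qpaths :: "('v, 'a) pre_digraph \<Rightarrow> ('v, 'a) qpath set" where
  "qpaths G = {(u, p). \<exists>v. pre_digraph.awalk G u p v}"

definition path_end :: "('v, 'a) pre_digraph \<Rightarrow> ('v, 'a) qpath \<Rightarrow> 'v" where
  "path_end G p = pre_digraph.awlast G (fst p) (snd p)"

definition path_mult ::
  "('v, 'a) pre_digraph \<Rightarrow> (('v, 'a) qpath \<Rightarrow>\<^sub>0 complex) \<Rightarrow> (('v, 'a) qpath \<Rightarrow>\<^sub>0 complex)
    \<Rightarrow> (('v, 'a) qpath \<Rightarrow>\<^sub>0 complex)" where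
  "path_mult G f g =
    (\<Sum>p\<in>Poly_Mapping.keys f. \<Sum>q\<in>Poly_Mapping.keys g.
       if path_end G p = fst q
       then Poly_Mapping.single (fst p, snd p @ snd q)
              (Poly_Mapping.lookup f p * Poly_Mapping.lookup g q)
       else 0)"

definition path_smult :: "complex \<Rightarrow> ('p \<Rightarrow>\<^sub>0 complex) \<Rightarrow> ('p \<Rightarrow>\<^sub>0 complex)" where
  "path_smult c f = Poly_Mapping.map ((*) c) f"

text \<open>
  A (possibly noncommutative) complex algebra is carried by the record type
  \<^typ>\<open>(complex, 'b) module\<close>, which has both a ring multiplication and a scalar multiplication.
\<close>

definition path_algebra ::
  "('v, 'a) pre_digraph \<Rightarrow> (complex, ('v, 'a) qpath \<Rightarrow>\<^sub>0 complex) module" where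
  "path_algebra G =
    \<lparr> carrier = {f. Poly_Mapping.keys f \<subseteq> qpaths G},
      monoid.mult = path_mult G,
      one = (\<Sum>v\<in>verts G. Poly_Mapping.single (v, []) 1),
      zero = 0,
      add = (+),
      smult = path_smult \<rparr>"

definition quotient_algebra :: "('k, 'b) module \<Rightarrow> 'b set \<Rightarrow> ('k, 'b set) module" where
  "quotient_algebra A I =
    ring.extend (A Quot I) (module.fields (\<lambda>c X. I <+>\<^bsub>A\<^esub> ((\<lambda>x. c \<odot>\<^bsub>A\<^esub> x) ` X)))"

definition algebra_iso :: "('k, 'b) module \<Rightarrow> ('k, 'c) module \<Rightarrow> ('b \<Rightarrow> 'c) set" where
  "algebra_iso A B =
    {h \<in> ring_iso A B. \<forall>c. \<forall>x \<in> carrier A. h (c \<odot>\<^bsub>A\<^esub> x) = c \<odot>\<^bsub>B\<^esub> h x}"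

definition is_algebra_iso :: "('k, 'b) module \<Rightarrow> ('k, 'c) module \<Rightarrow> bool"
    (infix \<open>\<cong>\<^sub>a\<close> 50) where
  "A \<cong>\<^sub>a B \<longleftrightarrow> algebra_iso A B \<noteq> {}"


section \<open>Potentials and Jacobian algebras\<close>

text \<open>
  A cycle up to cyclic permutation is the set of all rotations of a closed walk,
  and a potential is a finitely supported function on such sets.
\<close>

definition cyc :: "'a list \<Rightarrow> 'a list set" where
  "cyc p = range (\<lambda>n. rotate n p)"

definition three_cycles :: "('v, 'a) pre_digraph \<Rightarrow> 'a list set set" where
  "three_cycles G = {cyc p | p. wf_digraph.closed_w G p \<and> length p = 3}"

type_synonym 'a potential = "'a list set \<Rightarrow>\<^sub>0 complex"

definition cycle_deriv ::
  "('v, 'a) pre_digraph \<Rightarrow> 'a \<Rightarrow> 'a list \<Rightarrow> (('v, 'a) qpath \<Rightarrow>\<^sub>0 complex)" where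
  "cycle_deriv G a p =
    (\<Sum>i | i < length p \<and> p ! i = a. Poly_Mapping.single (head G a, drop (Suc i) p @ take i p) 1)"

text \<open>The choice of a representative is immaterial by \<open>cycle_deriv_rotate\<close> below.\<close>

definition potential_deriv ::
  "('v, 'a) pre_digraph \<Rightarrow> 'a \<Rightarrow> 'a potential \<Rightarrow> (('v, 'a) qpath \<Rightarrow>\<^sub>0 complex)" where
  "potential_deriv G a W =
    (\<Sum>c\<in>Poly_Mapping.keys W.
       path_smult (Poly_Mapping.lookup W c) (cycle_deriv G a (SOME p. p \<in> c)))"

definition jacobian_algebra ::
  "('v, 'a) pre_digraph \<Rightarrow> 'a potential
    \<Rightarrow> (complex, (('v, 'a) qpath \<Rightarrow>\<^sub>0 complex) set) module" where
  "jacobian_algebra G W =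
    quotient_algebra (path_algebra G)
      (Idl\<^bsub>path_algebra G\<^esub> ((\<lambda>a. potential_deriv G a W) ` arcs G))"


section \<open>Triples\<close>

type_synonym triple = "int \<times> int \<times> int"

definition fvec :: "int \<Rightarrow> triple" where
  "fvec i = (if i mod 3 = 0 then (-1, 1, 0) else if i mod 3 = 1 then (0, -1, 1) else (1, 0, -1))"

fun \<omega> :: "triple \<Rightarrow> triple" where
  "\<omega> (x0, x1, x2) = (x1, x2, x0)"

definition cyc_equiv :: "triple \<Rightarrow> triple \<Rightarrow> bool" (infix \<open>\<sim>\<close> 50) where
  "u \<sim> v \<longleftrightarrow> v \<in> {u, \<omega> u, \<omega> (\<omega> u)}"

fun mod3 :: "triple \<Rightarrow> triple" where
  "mod3 (a, b, c) = (a mod 3, b mod 3, c mod 3)"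

definition lex_greater :: "triple \<Rightarrow> triple \<Rightarrow> bool" (infix \<open>\<succ>\<close> 50) where
  "x \<succ> y \<longleftrightarrow> (let gt = {(a :: int, b). a > b} in (x, y) \<in> gt <*lex*> gt <*lex*> gt)"

text \<open>The elements of \<open>\<nat>\<^sup>3\<close> with coordinate sum \<open>s - 1\<close>.\<close>

definition simplex_pts :: "int \<Rightarrow> triple set" where
  "simplex_pts s = {(x0, x1, x2). 0 \<le> x0 \<and> 0 \<le> x1 \<and> 0 \<le> x2 \<and> x0 + x1 + x2 = s - 1}"


section \<open>The quiver of type A and the coefficients of its 3-cycles\<close>

text \<open>The pair \<open>(x, i)\<close> stands for the arrow \<open>e\<^sub>x \<alpha>\<^sub>i\<close>.\<close>

definition quiver_A :: "int \<Rightarrow> (triple, triple \<times> int) pre_digraph" where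
  "quiver_A s =
    \<lparr> verts = simplex_pts s,
      arcs = {(x, i). i \<in> {0, 1, 2} \<and> x \<in> simplex_pts s \<and> x + fvec i \<in> simplex_pts s},
      tail = fst,
      head = (\<lambda>(x, i). x + fvec i) \<rparr>"

text \<open>\<open>path_A x [i\<^sub>0, i\<^sub>1, \<dots>]\<close> is the path \<open>e\<^sub>x \<alpha>\<^bsub>i\<^sub>0\<^esub> \<alpha>\<^bsub>i\<^sub>1\<^esub> \<dots>\<close>, with indices read modulo 3.\<close>

fun path_A :: "triple \<Rightarrow> int list \<Rightarrow> (triple \<times> int) list" where
  "path_A x [] = []"
| "path_A x (i # is) = (x, i mod 3) # path_A (x + fvec i) is"

definition rot_A :: "triple \<times> int \<Rightarrow> triple \<times> int" where
  "rot_A = (\<lambda>(x, i). (\<omega> x, (i - 1) mod 3))"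

definition orbit_A :: "(triple \<times> int) list set \<Rightarrow> (triple \<times> int) list set set" where
  "orbit_A d = {((`) (map rot_A) ^^ n) d | n. True}"

definition qroot :: "int \<Rightarrow> complex" where
  "qroot s = exp (complex_of_real pi * \<i> / of_int (s + 2))"

definition qnum :: "int \<Rightarrow> int \<Rightarrow> complex" where
  "qnum s n =
    (qroot s powi n - qroot s powi (- n)) / (qroot s - qroot s powi (- 1))"

text \<open>
  In \<open>mu012\<close>, \<open>mu021\<close> and \<open>mu_D_word\<close> below, every radicand that occurs for a 3-cycle
  is a positive real number, whose positive square root is its \<^const>\<open>csqrt\<close>.
\<close>

fun mu012 :: "int \<Rightarrow> triple \<Rightarrow> complex" where
  "mu012 s (x0, x1, x2) =
    csqrt (qnum s (x1 + 1) * qnum s (x1 + 2) * qnum s (x2 + 1) * qnum s (x2 + 2)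
           * qnum s (x1 + x2 + 2) * qnum s (x1 + x2 + 3)) / qnum s 2"

fun mu021 :: "int \<Rightarrow> triple \<Rightarrow> complex" where
  "mu021 s (x0, x1, x2) =
    csqrt (qnum s (x1 + 1) * qnum s (x1 + 2) * qnum s x2 * qnum s (x2 + 1)
           * qnum s (x1 + x2 + 2) * qnum s (x1 + x2 + 3)) / qnum s 2"

text \<open>
  Every 3-cycle of \<open>quiver_A s\<close> is, up to rotation, \<open>e\<^sub>x \<alpha>\<^sub>0 \<alpha>\<^sub>1 \<alpha>\<^sub>2\<close> or \<open>e\<^sub>x \<alpha>\<^sub>0 \<alpha>\<^sub>2 \<alpha>\<^sub>1\<close> for exactly
  one \<open>x\<close>; see \<open>mu_A_simps\<close> below.
\<close>

definition mu_A :: "int \<Rightarrow> (triple \<times> int) list set \<Rightarrow> complex" where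
  "mu_A s d =
    (if \<exists>x. d = cyc (path_A x [0, 1, 2]) then mu012 s (THE x. d = cyc (path_A x [0, 1, 2]))
     else if \<exists>x. d = cyc (path_A x [0, 2, 1]) then mu021 s (THE x. d = cyc (path_A x [0, 2, 1]))
     else 0)"


section \<open>The quiver of type D\<close>

text \<open>
  \<open>Alpha x i j\<close> is the arrow \<open>e\<^sub>x \<alpha>\<^bsub>i,j\<^esub>\<close>, and \<open>Copy k\<close> is the copy \<open>X\<^sub>k\<close> of the centre \<open>X\<close>.
\<close>

datatype vertex_D = Vtx triple | Copy int

datatype arrow_D = is_Alpha: Alpha triple int int | Beta int | Gamma int

definition Q0 :: "int \<Rightarrow> triple set" where
  "Q0 s = {x \<in> simplex_pts s. x \<succ> \<omega> x \<and> x \<succ> \<omega> (\<omega> x)}"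

definition Q1 :: "int \<Rightarrow> arrow_D set" where
  "Q1 s = {Alpha x i j | x i j. i \<in> {0, 1, 2} \<and> j \<in> {0, 1, 2} \<and> x \<in> Q0 s
             \<and> (\<omega> ^^ nat j) x + fvec i \<in> Q0 s}"

text \<open>The index set of the \<open>X\<^sub>k\<close>, \<open>\<beta>\<^sub>k\<close>, \<open>\<gamma>\<^sub>k\<close>; when it is nonempty, \<open>t = s div 3\<close>.\<close>

definition copies :: "int \<Rightarrow> int set" where
  "copies s = (if \<exists>t > 0. s = 3 * t + 1 then {0, 1, 2} else {})"

definition centre :: "int \<Rightarrow> triple" where
  "centre s = (s div 3, s div 3, s div 3)"

fun tail_D :: "int \<Rightarrow> arrow_D \<Rightarrow> vertex_D" where
  "tail_D s (Alpha x i j) = Vtx x"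
| "tail_D s (Beta k) = Vtx (centre s - fvec 0)"
| "tail_D s (Gamma k) = Copy k"

fun head_D :: "int \<Rightarrow> arrow_D \<Rightarrow> vertex_D" where
  "head_D s (Alpha x i j) = Vtx ((\<omega> ^^ nat j) x + fvec i)"
| "head_D s (Beta k) = Copy k"
| "head_D s (Gamma k) = Vtx (centre s + fvec 2)"

definition quiver_D :: "int \<Rightarrow> (vertex_D, arrow_D) pre_digraph" where
  "quiver_D s =
    \<lparr> verts = Vtx ` Q0 s \<union> Copy ` copies s,
      arcs = Q1 s \<union> Beta ` copies s \<union> Gamma ` copies s,
      tail = tail_D s,
      head = head_D s \<rparr>"


section \<open>The two potentials of type D\<close>

definition \<zeta> :: complex where
  "\<zeta> = exp (2 * complex_of_real pi * \<i> / 3)"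

fun lambda_D_word :: "arrow_D list \<Rightarrow> complex" where
  "lambda_D_word [Alpha x i0 j0, Alpha y i1 j1, Alpha z i2 j2] =
    (let u = mod3 (i0 + j0, i1 - j2, i2) in
     if distinct [Alpha x i0 j0, Alpha y i1 j1, Alpha z i2 j2] then
       (if (j0 + j1 + j2) mod 3 \<noteq> 0 then 0
        else if u \<sim> (0, 1, 2) then 1
        else if u \<sim> (0, 2, 1) then - 1
        else 0)
     else if Alpha x i0 j0 = Alpha y i1 j1 \<and> Alpha y i1 j1 = Alpha z i2 j2 then
       (if u \<sim> (0, 1, 2) then 1 / 3
        else if u \<sim> (0, 2, 1) then - 1 / 3
        else 0)
     else 0)"
| "lambda_D_word [Alpha x i j, Beta k, Gamma l] =
    (if (i, j) = (1, 0) then - 1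
     else if (i, j) = (2, 1) then \<zeta> powi k
     else 0)"
| "lambda_D_word _ = 0"

fun mu_D_word :: "int \<Rightarrow> arrow_D list \<Rightarrow> complex" where
  "mu_D_word s [Alpha x i0 j0, Alpha y i1 j1, Alpha z i2 j2] =
    (if (j0 + j1 + j2) mod 3 \<noteq> 0 then 0
     else let d = cyc (path_A x [i0 + j0, i1 - j2, i2])
          in mu_A s d * of_nat (card (orbit_A d)) / 3)"
| "mu_D_word s [Alpha x i j, Beta k, Gamma l] =
    (let t = s div 3 in
     if (i, j) = (1, 0) then
       \<zeta> powi k * (qnum s t * csqrt (qnum s (t + 1) ^ 3 * qnum s (t + 2)) / (csqrt 3 * qnum s 2))
     else if (i, j) = (2, 1) then
       \<zeta> powi (- k) * (qnum s (t + 2) * csqrt (qnum s t * qnum s (t + 1) ^ 3) / (csqrt 3 * qnum s 2))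
     else 0)"
| "mu_D_word s _ = 0"

text \<open>
  Every 3-cycle of \<open>quiver_D s\<close> has a rotation that begins with an arrow \<open>Alpha\<close>. It is
  unique if the cycle contains some \<open>Beta k\<close>. If the cycle consists of arrows \<open>Alpha\<close>, all
  its rotations have the same coefficients.
\<close>

definition alpha_rep :: "arrow_D list set \<Rightarrow> arrow_D list" where
  "alpha_rep c = (SOME p. p \<in> c \<and> is_Alpha (hd p))"

definition W_D :: "int \<Rightarrow> arrow_D potential" where
  "W_D s = (\<Sum>c\<in>three_cycles (quiver_D s). Poly_Mapping.single c (lambda_D_word (alpha_rep c)))"

definition V_D :: "int \<Rightarrow> arrow_D potential" where
  "V_D s = (\<Sum>c\<in>three_cycles (quiver_D s). Poly_Mapping.single c (mu_D_word s (alpha_rep c)))"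

definition Pi_D :: "int \<Rightarrow> (complex, ((vertex_D, arrow_D) qpath \<Rightarrow>\<^sub>0 complex) set) module" where
  "Pi_D s = jacobian_algebra (quiver_D s) (W_D s)"



section \<open>Well-definedness\<close>

lemma cycle_deriv_alt:
  "cycle_deriv G a p =
    (\<Sum>i<length p. if p ! i = a
       then Poly_Mapping.single (head G a, drop (Suc i) p @ take i p) 1 else 0)"
  unfolding cycle_deriv_def
  by (subst sum.inter_filter[symmetric]) (auto intro!: sum.cong)

lemma cycle_deriv_rotate: "cycle_deriv G a (rotate n p) = cycle_deriv G a p"
proof (induction n)
  case (Suc n)
  have "cycle_deriv G a (rotate1 p) = cycle_deriv G a p" for p
  proof (cases p)
    case (Cons x xs)
    have "cycle_deriv G a (xs @ [x]) = (\<Sum>i<length xs. if xs ! i = a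
        then Poly_Mapping.single (head G a, drop (Suc i) xs @ x # take i xs) 1 else 0)
        + (if x = a then Poly_Mapping.single (head G a, xs) 1 else 0)"
      (is "_ = ?S + ?T")
    proof -
      have "(if (xs @ [x]) ! i = a then Poly_Mapping.single
            (head G a, drop (Suc i) (xs @ [x]) @ take i (xs @ [x])) 1 else 0) =
          (if xs ! i = a
           then Poly_Mapping.single (head G a, drop (Suc i) xs @ x # take i xs) (1 :: complex) else 0)"
        if "i < length xs" for i
        using that by (simp add: nth_append)
      then show ?thesis unfolding cycle_deriv_alt by simp
    qed
    moreover have "cycle_deriv G a (x # xs) = ?T + ?S"
      unfolding cycle_deriv_alt length_Cons sum.lessThan_Suc_shift by (simp cong: if_cong)
    ultimately have "cycle_deriv G a (xs @ [x]) = cycle_deriv G a (x # xs)"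
      by (simp only: add.commute)
    with Cons show ?thesis by simp
  qed simp
  with Suc show ?case by simp
qed simp

lemma mem_cyc_3: "p \<in> cyc [a, b, c] \<longleftrightarrow> p \<in> {[a, b, c], [b, c, a], [c, a, b]}"
proof -
  have "rotate n [a, b, c] \<in> {[a, b, c], [b, c, a], [c, a, b]}" for n
  proof (induction n)
    case (Suc n)
    then show ?case by (elim insertE emptyE) (simp_all only: rotate_Suc rotate1.simps append.simps insert_iff simp_thms)
  qed simp
  moreover have "[a, b, c] = rotate 0 [a, b, c]" "[b, c, a] = rotate 1 [a, b, c]"
    "[c, a, b] = rotate 2 [a, b, c]"
    by (simp_all add: numeral_2_eq_2)
  ultimately show ?thesis unfolding cyc_def by blast
qed

lemma cyc_3_eq_iff:
  fixes a b c a' b' c' :: 'a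
  shows "cyc [a, b, c] = cyc [a', b', c'] \<longleftrightarrow> [a, b, c] \<in> {[a', b', c'], [b', c', a'], [c', a', b']}"
proof
  assume "cyc [a, b, c] = cyc [a', b', c']"
  then show "[a, b, c] \<in> {[a', b', c'], [b', c', a'], [c', a', b']}"
    using mem_cyc_3[of "[a, b, c]" a b c] mem_cyc_3[of "[a, b, c]" a' b' c'] by blast
next
  have eq: "cyc [a, b, c] = {[a, b, c], [b, c, a], [c, a, b]}" for a b c :: 'a
    using mem_cyc_3[of _ a b c] by blast
  assume "[a, b, c] \<in> {[a', b', c'], [b', c', a'], [c', a', b']}"
  then consider "a = a'" "b = b'" "c = c'" | "a = b'" "b = c'" "c = a'" | "a = c'" "b = a'" "c = b'"
    by blast
  then show "cyc [a, b, c] = cyc [a', b', c']"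
    by cases (simp_all only: eq, blast+)
qed

lemma mu_A_simps:
  "mu_A s (cyc (path_A x [0, 1, 2])) = mu012 s x"
  "mu_A s (cyc (path_A x [0, 2, 1])) = mu021 s x"
proof -
  have "cyc (path_A x [0, 1, 2]) = cyc (path_A y [0, 1, 2]) \<longleftrightarrow> y = x"
    "cyc (path_A x [0, 2, 1]) = cyc (path_A y [0, 2, 1]) \<longleftrightarrow> y = x"
    "cyc (path_A x [0, 2, 1]) \<noteq> cyc (path_A y [0, 1, 2])" for y
    by (auto simp: cyc_3_eq_iff)
  then show "mu_A s (cyc (path_A x [0, 1, 2])) = mu012 s x"
    "mu_A s (cyc (path_A x [0, 2, 1])) = mu021 s x"
    unfolding mu_A_def by (simp_all del: path_A.simps)
qed

lemma path_end_append:
  "path_end G p = fst r \<Longrightarrow> path_end G (fst p, snd p @ snd r) = path_end G r"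
  by (cases "snd r") (auto simp: path_end_def pre_digraph.awalk_verts_conv)

lemma path_mult_superset:
  assumes "finite A" "finite B" "Poly_Mapping.keys g \<subseteq> A" "Poly_Mapping.keys h \<subseteq> B"
  shows "path_mult G g h = (\<Sum>p\<in>A. \<Sum>r\<in>B. if path_end G p = fst r
       then Poly_Mapping.single (fst p, snd p @ snd r)
              (Poly_Mapping.lookup g p * Poly_Mapping.lookup h r)
       else 0)"
proof -
  have "path_mult G g h = (\<Sum>p\<in>Poly_Mapping.keys g. \<Sum>r\<in>B. if path_end G p = fst r
       then Poly_Mapping.single (fst p, snd p @ snd r)
              (Poly_Mapping.lookup g p * Poly_Mapping.lookup h r)
       else 0)"
    unfolding path_mult_def
    using assms by (intro sum.cong refl sum.mono_neutral_left) (auto simp: in_keys_iff)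
  also have "\<dots> = (\<Sum>p\<in>A. \<Sum>r\<in>B. if path_end G p = fst r
       then Poly_Mapping.single (fst p, snd p @ snd r)
              (Poly_Mapping.lookup g p * Poly_Mapping.lookup h r)
       else 0)"
    using assms by (intro sum.mono_neutral_left) (auto simp: in_keys_iff intro!: sum.neutral)
  finally show ?thesis .
qed

lemma path_mult_add_left: "path_mult G (g + g') h = path_mult G g h + path_mult G g' h"
proof -
  let ?A = "Poly_Mapping.keys g \<union> Poly_Mapping.keys g'" and ?B = "Poly_Mapping.keys h"
  have S: "path_mult G u h = (\<Sum>p\<in>?A. \<Sum>r\<in>?B. if path_end G p = fst r
       then Poly_Mapping.single (fst p, snd p @ snd r) (Poly_Mapping.lookup u p * Poly_Mapping.lookup h r) else 0)"
    if "Poly_Mapping.keys u \<subseteq> ?A" for u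
    by (rule path_mult_superset) (use that in auto)
  show ?thesis
    unfolding S[OF Poly_Mapping.keys_add] S[OF Un_upper1] S[OF Un_upper2] sum.distrib[symmetric]
    by (intro sum.cong refl) (simp add: lookup_add ring_distribs single_add)
qed

lemma path_mult_add_right: "path_mult G h (g + g') = path_mult G h g + path_mult G h g'"
proof -
  let ?A = "Poly_Mapping.keys g \<union> Poly_Mapping.keys g'" and ?B = "Poly_Mapping.keys h"
  have S: "path_mult G h u = (\<Sum>p\<in>?B. \<Sum>r\<in>?A. if path_end G p = fst r
       then Poly_Mapping.single (fst p, snd p @ snd r) (Poly_Mapping.lookup h p * Poly_Mapping.lookup u r) else 0)"
    if "Poly_Mapping.keys u \<subseteq> ?A" for u
    by (rule path_mult_superset) (use that in auto)
  show ?thesis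
    unfolding S[OF Poly_Mapping.keys_add] S[OF Un_upper1] S[OF Un_upper2] sum.distrib[symmetric]
    by (intro sum.cong refl) (simp add: lookup_add ring_distribs single_add)
qed

lemma path_mult_zero [simp]: "path_mult G 0 h = 0" "path_mult G h 0 = 0"
  by (simp_all add: path_mult_def)

lemma path_mult_single:
  "path_mult G (Poly_Mapping.single p a) (Poly_Mapping.single r b) =
    (if path_end G p = fst r then Poly_Mapping.single (fst p, snd p @ snd r) (a * b) else 0)"
  by (subst path_mult_superset[of "{p}" "{r}"]) auto

lemma path_mult_sum_left: "path_mult G (sum F A) h = (\<Sum>x\<in>A. path_mult G (F x) h)"
  by (induction A rule: infinite_finite_induct) (auto simp: path_mult_add_left)

lemma path_mult_sum_right: "path_mult G h (sum F A) = (\<Sum>x\<in>A. path_mult G h (F x))"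
  by (induction A rule: infinite_finite_induct) (auto simp: path_mult_add_right)

lemma poly_mapping_single_induct [case_names zero add single]:
  fixes g :: "'p \<Rightarrow>\<^sub>0 complex"
  assumes "P 0" "\<And>g h. P g \<Longrightarrow> P h \<Longrightarrow> P (g + h)" "\<And>p c. p \<in> Poly_Mapping.keys g \<Longrightarrow> P (Poly_Mapping.single p c)"
  shows "P g"
proof -
  have "P (\<Sum>p\<in>A. Poly_Mapping.single p (Poly_Mapping.lookup g p))" if "finite A" "A \<subseteq> Poly_Mapping.keys g" for A
    using that by (induction A) (auto intro: assms)
  moreover have "(\<Sum>p\<in>Poly_Mapping.keys g. Poly_Mapping.single p (Poly_Mapping.lookup g p)) = g"
    by (rule poly_mapping_eqI) (simp add: lookup_sum lookup_single when_def sum.delta' in_keys_iff)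
  ultimately show ?thesis by (metis finite_keys order.refl)
qed

lemma path_mult_assoc: "path_mult G (path_mult G g h) k = path_mult G g (path_mult G h k)"
proof (induction g rule: poly_mapping_single_induct)
  case (single p a)
  show ?case
  proof (induction h rule: poly_mapping_single_induct)
    case (single r b)
    show ?case
    proof (induction k rule: poly_mapping_single_induct)
      case (single t c)
      then show ?case
        by (auto simp: path_mult_single path_end_append)
           (simp_all add: path_end_def mult.assoc)
    qed (simp_all add: path_mult_add_left path_mult_add_right)
  qed (simp_all add: path_mult_add_left path_mult_add_right)
qed (simp_all add: path_mult_add_left path_mult_add_right)



lemma potential_deriv_single_cyc:
  "potential_deriv G a (Poly_Mapping.single (cyc p) c) = path_smult c (cycle_deriv G a p)"
proof -
  have "p \<in> cyc p" by (auto simp: cyc_def intro: range_eqI[of _ _ 0])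
  then have "(SOME r. r \<in> cyc p) \<in> cyc p" by (rule someI)
  then have "cycle_deriv G a (SOME r. r \<in> cyc p) = cycle_deriv G a p"
    by (auto simp: cyc_def cycle_deriv_rotate)
  then show ?thesis by (cases "c = 0") (auto simp: potential_deriv_def path_smult_def map_eq_zero_iff intro!: poly_mapping_eqI)
qed

lemma lookup_path_smult: "Poly_Mapping.lookup (path_smult c g) k = c * Poly_Mapping.lookup g k"
  by (simp add: path_smult_def map.rep_eq when_def)

lemma path_smult_simps [simp]:
  "path_smult c (g + h) = path_smult c g + path_smult c h" "path_smult c 0 = 0"
  "path_smult c (Poly_Mapping.single p a) = Poly_Mapping.single p (c * a)"
  by (auto simp: lookup_path_smult lookup_add lookup_single when_def distrib_left
      intro!: poly_mapping_eqI)

lemma path_mult_smult: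
  "path_mult G (path_smult c g) h = path_smult c (path_mult G g h)"
  "path_mult G g (path_smult c h) = path_smult c (path_mult G g h)"
proof -
  show "path_mult G (path_smult c g) h = path_smult c (path_mult G g h)"
  proof (induction g rule: poly_mapping_single_induct)
    case (single p a)
    show ?case
      by (induction h rule: poly_mapping_single_induct) (simp_all add: path_mult_single path_mult_add_right ac_simps)
  qed (simp_all add: path_mult_add_left)
  show "path_mult G g (path_smult c h) = path_smult c (path_mult G g h)"
  proof (induction g rule: poly_mapping_single_induct)
    case (single p a)
    show ?case
      by (induction h rule: poly_mapping_single_induct) (simp_all add: path_mult_single path_mult_add_right ac_simps)
  qed (simp_all add: path_mult_add_left)
qed

context fin_digraph
begin

lemma qpaths_closed:
  assumes "p \<in> qpaths G" "r \<in> qpaths G" "path_end G p = fst r"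
  shows "(fst p, snd p @ snd r) \<in> qpaths G"
proof -
  from assms obtain v w where "awalk (fst p) (snd p) v" "awalk (fst r) (snd r) w"
    by (auto simp: qpaths_def)
  moreover from this(1) have "v = fst r" using assms(3)
    unfolding path_end_def by (elim awalkE') simp
  ultimately have "awalk (fst p) (snd p @ snd r) w" by (auto intro: awalk_appendI)
  then show ?thesis unfolding qpaths_def by blast
qed

lemma path_mult_closed:
  assumes "Poly_Mapping.keys g \<subseteq> qpaths G" "Poly_Mapping.keys h \<subseteq> qpaths G"
  shows "Poly_Mapping.keys (path_mult G g h) \<subseteq> qpaths G"
  unfolding path_mult_def
  using assms by (intro order.trans[OF keys_sum] UN_least) (auto intro: qpaths_closed)

lemma one_path_mult:
  assumes "Poly_Mapping.keys g \<subseteq> qpaths G"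
  shows "path_mult G (\<Sum>v\<in>verts G. Poly_Mapping.single (v, []) 1) g = g"
proof (induction g rule: poly_mapping_single_induct)
  case (single p c)
  with assms have "fst p \<in> verts G" by (auto simp: qpaths_def awalk_def)
  then show ?case
    by (simp add: path_mult_sum_left path_mult_single path_end_def sum.delta if_distrib)
qed (simp_all add: path_mult_add_right)

lemma path_mult_one:
  assumes "Poly_Mapping.keys g \<subseteq> qpaths G"
  shows "path_mult G g (\<Sum>v\<in>verts G. Poly_Mapping.single (v, []) 1) = g"
proof (induction g rule: poly_mapping_single_induct)
  case (single p c)
  with assms obtain v where "awalk (fst p) (snd p) v" by (auto simp: qpaths_def)
  then have "path_end G p \<in> verts G"
    unfolding path_end_def by (elim awalkE') simp
  then show ?case
    by (simp add: path_mult_sum_right path_mult_single sum.delta sum.delta' if_distrib)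
qed (simp_all add: path_mult_add_left)

lemma ring_path_algebra: "ring (path_algebra G)"
proof (rule ringI)
  show "abelian_group (path_algebra G)"
  proof (rule abelian_groupI)
    fix g assume "g \<in> carrier (path_algebra G)"
    then show "\<exists>h\<in>carrier (path_algebra G). h \<oplus>\<^bsub>path_algebra G\<^esub> g = \<zero>\<^bsub>path_algebra G\<^esub>"
      by (intro bexI[of _ "- g"]) (auto simp: path_algebra_def)
  qed (use Poly_Mapping.keys_add in \<open>fastforce simp: path_algebra_def algebra_simps\<close>)+
  show "Group.monoid (path_algebra G)"
  proof (rule monoidI)
    show "\<one>\<^bsub>path_algebra G\<^esub> \<in> carrier (path_algebra G)"
      by (auto simp: path_algebra_def qpaths_def awalk_def intro!: order.trans[OF keys_sum])
  qed (auto simp: path_algebra_def path_mult_assoc one_path_mult path_mult_one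
        dest: path_mult_closed[THEN subsetD, rotated -1])
qed (auto simp: path_algebra_def path_mult_add_left path_mult_add_right)

lemma path_smult_closed:
  "Poly_Mapping.keys g \<subseteq> qpaths G \<Longrightarrow> Poly_Mapping.keys (path_smult c g) \<subseteq> qpaths G"
  by (auto simp: path_smult_def in_keys_iff map.rep_eq when_def split: if_splits)

lemma cycle_deriv_closed:
  assumes "closed_w p"
  shows "Poly_Mapping.keys (cycle_deriv G a p) \<subseteq> qpaths G"
proof -
  have "(head G a, drop (Suc i) p @ take i p) \<in> qpaths G" if i: "i < length p" "p ! i = a" for i
  proof -
    from assms obtain u where "awalk u p u" by (auto simp: closed_w_def)
    also have "p = take i p @ a # drop (Suc i) p" using i id_take_nth_drop by metis
    finally have "awalk u (take i p) (tail G a)" "awalk (head G a) (drop (Suc i) p) u"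
      by (auto simp: awalk_append_iff awalk_Cons_iff)
    then show ?thesis by (auto simp: qpaths_def)
  qed
  then show ?thesis
    unfolding cycle_deriv_def by (intro order.trans[OF keys_sum] UN_least) auto
qed

lemma closed_w_rotate: "closed_w p \<Longrightarrow> closed_w (rotate n p)"
proof (induction n)
  case (Suc n)
  have "closed_w (rotate1 p)" if "closed_w p" for p
  proof (cases p)
    case (Cons a r)
    with that obtain u where "awalk u (a # r) u" by (auto simp: closed_w_def)
    then have "awalk (head G a) (r @ [a]) (head G a)"
      by (auto simp: awalk_append_iff awalk_Cons_iff awalk_Nil_iff)
    with Cons show ?thesis by (auto simp: closed_w_def)
  qed (use that in simp)
  with Suc show ?case by simp
qed simp

lemma potential_deriv_closed:
  assumes "Poly_Mapping.keys W \<subseteq> {cyc p | p. closed_w p}"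
  shows "potential_deriv G a W \<in> carrier (path_algebra G)"
proof -
  have "closed_w (SOME r. r \<in> c)" if "c \<in> Poly_Mapping.keys W" for c
  proof -
    from that assms obtain p where p: "c = cyc p" "closed_w p" by auto
    then have "p \<in> c" by (auto simp: cyc_def intro: range_eqI[of _ _ 0])
    then have "(SOME r. r \<in> c) \<in> c" by (rule someI)
    with p show ?thesis by (auto simp: cyc_def closed_w_rotate)
  qed
  then show ?thesis
    unfolding potential_deriv_def path_algebra_def
    by (auto intro!: order.trans[OF keys_sum] UN_least path_smult_closed cycle_deriv_closed)
qed

lemma quotient_smult:
  assumes "ideal I (path_algebra G)" "x \<in> carrier (path_algebra G)"
  shows "c \<odot>\<^bsub>quotient_algebra (path_algebra G) I\<^esub> (I +>\<^bsub>path_algebra G\<^esub> x) =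
    I +>\<^bsub>path_algebra G\<^esub> (c \<odot>\<^bsub>path_algebra G\<^esub> x)"
proof -
  interpret I: ideal I "path_algebra G" by fact
  have smult: "path_smult c k \<in> I" if "k \<in> I" for c k
  proof -
    let ?one = "\<Sum>v\<in>verts G. Poly_Mapping.single (v, []) 1"
    have k: "Poly_Mapping.keys k \<subseteq> qpaths G"
      using I.a_Hcarr[OF that] by (simp add: path_algebra_def)
    have "path_smult c ?one \<in> carrier (path_algebra G)"
      using I.one_closed by (simp add: path_algebra_def path_smult_closed)
    from I.I_l_closed[OF that this] have "path_mult G (path_smult c ?one) k \<in> I"
      by (simp add: path_algebra_def)
    then show ?thesis by (simp add: path_mult_smult one_path_mult[OF k])
  qed
  have add: "h + k \<in> I" if "h \<in> I" "k \<in> I" for h k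
    using subgroup.m_closed[OF I.a_subgroup that] by (simp add: path_algebra_def)
  have zero: "0 \<in> I" using subgroup.one_closed[OF I.a_subgroup] by (simp add: path_algebra_def)
  have coset: "I +>\<^bsub>path_algebra G\<^esub> y = (\<lambda>h. h + y) ` I" for y
    by (auto simp: a_r_coset_def r_coset_def path_algebra_def)
  have "c \<odot>\<^bsub>quotient_algebra (path_algebra G) I\<^esub> (I +>\<^bsub>path_algebra G\<^esub> x) =
      {h + path_smult c (k + x) | h k. h \<in> I \<and> k \<in> I}"
    unfolding coset
    by (auto simp: quotient_algebra_def ring.extend_def module.fields_def set_add_def'
        path_algebra_def)
  also have "\<dots> = (\<lambda>h. h + path_smult c x) ` I"
  proof (intro equalityI subsetI)
    fix y assume "y \<in> {h + path_smult c (k + x) | h k. h \<in> I \<and> k \<in> I}"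
    then obtain h k where "h \<in> I" "k \<in> I" "y = (h + path_smult c k) + path_smult c x"
      by (auto simp: add.assoc)
    then show "y \<in> (\<lambda>h. h + path_smult c x) ` I" by (blast intro: add smult)
  next
    fix y assume "y \<in> (\<lambda>h. h + path_smult c x) ` I"
    then show "y \<in> {h + path_smult c (k + x) | h k. h \<in> I \<and> k \<in> I}"
      using zero by (force intro: exI[of _ 0])
  qed
  finally show ?thesis by (simp add: coset) (simp add: path_algebra_def)
qed

end

lemma finite_simplex: "finite (simplex_pts s)"
proof (rule finite_subset)
  show "simplex_pts s \<subseteq> {0..s} \<times> {0..s} \<times> {0..s}" by (auto simp: simplex_pts_def)
qed auto

lemma fin_digraph_quiver_A: "fin_digraph (quiver_A s)"
proof
  show "finite (verts (quiver_A s))" by (simp add: quiver_A_def finite_simplex)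
  have "arcs (quiver_A s) \<subseteq> simplex_pts s \<times> {0, 1, 2}" by (auto simp: quiver_A_def)
  then show "finite (arcs (quiver_A s))" by (rule finite_subset) (simp add: finite_simplex)
qed (auto simp: quiver_A_def)

lemma fin_digraph_quiver_D: "fin_digraph (quiver_D s)"
proof
  have fQ0: "finite (Q0 s)" by (simp add: Q0_def finite_simplex)
  have fc: "finite (copies s)" by (simp add: copies_def)
  show "finite (verts (quiver_D s))" by (simp add: quiver_D_def fQ0 fc)
  have "Q1 s \<subseteq> (\<Union>x\<in>Q0 s. \<Union>i\<in>{0, 1, 2}. \<Union>j\<in>{0, 1, 2}. {Alpha x i j})"
    unfolding Q1_def by blast
  then have "finite (Q1 s)" by (rule finite_subset) (simp add: fQ0)
  then show "finite (arcs (quiver_D s))" by (simp add: quiver_D_def fc)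
  fix e assume e: "e \<in> arcs (quiver_D s)"
  have *: "centre s - fvec 0 \<in> Q0 s" "centre s + fvec 2 \<in> Q0 s" if "k \<in> copies s" for k
    using that by (auto simp: centre_def fvec_def Q0_def simplex_pts_def lex_greater_def copies_def split: if_splits)
  from e * show "tail (quiver_D s) e \<in> verts (quiver_D s)" "head (quiver_D s) e \<in> verts (quiver_D s)"
    by (auto simp: quiver_D_def Q1_def)
qed

lemma finite_three_cycles:
  assumes "fin_digraph G" shows "finite (three_cycles G)"
proof -
  interpret fin_digraph G by fact
  have "three_cycles G \<subseteq> cyc ` {p. set p \<subseteq> arcs G \<and> length p = 3}"
    by (auto simp: three_cycles_def closed_w_def awalk_def)
  then show ?thesis by (rule finite_subset) (simp add: finite_lists_length_eq)
qed

lemma keys_W_D_V_D: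
  "Poly_Mapping.keys (W_D s) \<subseteq> three_cycles (quiver_D s)"
  "Poly_Mapping.keys (V_D s) \<subseteq> three_cycles (quiver_D s)"
  by (auto simp: W_D_def V_D_def intro!: order.trans[OF keys_sum] UN_least split: if_splits)

lemma omega_pow_add: "(\<omega> ^^ n) (x + y) = (\<omega> ^^ n) x + (\<omega> ^^ n) y"
proof -
  have "\<omega> (u + v) = \<omega> u + \<omega> v" for u v by (cases u; cases v) simp
  then show ?thesis by (induction n) simp_all
qed

lemma omega_pow_fvec: "(\<omega> ^^ n) (fvec i) = fvec (i - int n)"
proof (induction n)
  case (Suc n)
  have "\<omega> (fvec k) = fvec (k - 1)" for k
  proof -
    define m where "m = k div 3"
    have "k = 3 * m + k mod 3" "0 \<le> k mod 3" "k mod 3 < 3" by (simp_all add: m_def)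
    then consider "k = 3 * m" | "k = 3 * m + 1" | "k = 3 * m + 2" by linarith
    then show ?thesis
    proof cases
      case 1
      then have "k - 1 = 2 + 3 * (m - 1)" by simp
      then have "(k - 1) mod 3 = 2" by (simp only: mod_mult_self2) simp
      with 1 show ?thesis by (simp add: fvec_def)
    next
      case 2
      then show ?thesis by (simp add: fvec_def)
    next
      case 3
      then have "(k - 1) mod 3 = 1" "k mod 3 = 2" by simp_all
      then show ?thesis by (simp add: fvec_def)
    qed
  qed
  with Suc show ?case by (simp add: algebra_simps)
qed simp

lemma omega_pow_simplex: "(\<omega> ^^ n) x \<in> simplex_pts s \<longleftrightarrow> x \<in> simplex_pts s"
proof (induction n)
  case (Suc n)
  have "\<omega> y \<in> simplex_pts s \<longleftrightarrow> y \<in> simplex_pts s" for y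
    by (cases y) (auto simp: simplex_pts_def)
  with Suc show ?case by simp
qed simp

lemma omega_pow_3: "(\<omega> ^^ (3 * m)) x = x"
proof (induction m)
  case (Suc m)
  have "(\<omega> ^^ 3) y = y" for y by (cases y) (simp add: numeral_3_eq_3)
  with Suc show ?case by (simp only: mult_Suc_right funpow_add o_apply)
qed simp

lemma closed_w_lift:
  assumes "wf_digraph.closed_w (quiver_D s) [Alpha x i0 j0, Alpha y i1 j1, Alpha z i2 j2]"
    and "(j0 + j1 + j2) mod 3 = 0"
  shows "wf_digraph.closed_w (quiver_A s) (path_A x [i0 + j0, i1 - j2, i2])"
proof -
  interpret D: fin_digraph "quiver_D s" by (rule fin_digraph_quiver_D)
  interpret A: fin_digraph "quiver_A s" by (rule fin_digraph_quiver_A)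
  define n0 n1 n2 where "n0 = nat j0" and "n1 = nat j1" and "n2 = nat j2"
  have w: "x \<in> Q0 s" "y \<in> Q0 s" "z \<in> Q0 s" "0 \<le> j0" "0 \<le> j1" "0 \<le> j2"
    "y = (\<omega> ^^ n0) x + fvec i0" "z = (\<omega> ^^ n1) y + fvec i1" "x = (\<omega> ^^ n2) z + fvec i2"
  proof -
    have tl: "tail (quiver_D s) = tail_D s" "head (quiver_D s) = head_D s"
      by (simp_all add: quiver_D_def)
    have Q1: "x \<in> Q0 s \<and> 0 \<le> j" if "Alpha x i j \<in> Q1 s" for x i j
      using that by (auto simp: Q1_def)
    have arc: "Alpha x i j \<in> Q1 s" if "Alpha x i j \<in> arcs (quiver_D s)" for x i j
      using that by (auto simp: quiver_D_def)
    have "Alpha x i0 j0 \<in> Q1 s" "Alpha y i1 j1 \<in> Q1 s" "Alpha z i2 j2 \<in> Q1 s"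
      using assms(1) by (auto simp: D.closed_w_def D.awalk_def intro!: arc)
    then show "x \<in> Q0 s" "y \<in> Q0 s" "z \<in> Q0 s" "0 \<le> j0" "0 \<le> j1" "0 \<le> j2"
      using Q1 by blast+
    show "y = (\<omega> ^^ n0) x + fvec i0" "z = (\<omega> ^^ n1) y + fvec i1" "x = (\<omega> ^^ n2) z + fvec i2"
      using assms(1)
      by (auto simp: D.closed_w_def D.awalk_def tl n0_def n1_def n2_def)
  qed
  have j: "j0 = int n0" "j1 = int n1" "j2 = int n2"
    using w(4-6) by (simp_all add: n0_def n1_def n2_def)
  have f_mod: "fvec (k mod 3) = fvec k" for k by (simp add: fvec_def)
  have f_cong: "fvec k = fvec l" if "k mod 3 = l mod 3" for k l
    using that by (simp add: fvec_def)
  define a b where "a = x + fvec (i0 + j0)" and "b = a + fvec (i1 - j2)"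
  have y: "y = (\<omega> ^^ n0) a"
    using w(7) by (simp add: a_def omega_pow_add omega_pow_fvec j)
  have e: "fvec (i1 - int n2) = fvec (i1 + int n0 + int n1)"
  proof (rule f_cong)
    from assms(2) have "3 dvd int n0 + int n1 + int n2" by (simp add: j mod_eq_0_iff_dvd)
    then have "3 dvd - (int n0 + int n1 + int n2)" by (simp only: dvd_minus_iff)
    then show "(i1 - int n2) mod 3 = (i1 + int n0 + int n1) mod 3"
      by (simp add: mod_eq_dvd_iff algebra_simps)
  qed
  have z: "z = (\<omega> ^^ (n1 + n0)) b"
    using w(8) by (simp add: b_def y omega_pow_add omega_pow_fvec j funpow_add e)
  have "int (n2 + (n1 + n0)) mod 3 = 0" using assms(2) by (simp add: j algebra_simps)
  then have "3 dvd n2 + (n1 + n0)" by (metis dvd_eq_mod_eq_0 int_dvd_int_iff of_nat_numeral)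
  then obtain m where m: "n2 + (n1 + n0) = 3 * m" by (rule dvdE)
  have "(\<omega> ^^ n2) z = (\<omega> ^^ (n2 + (n1 + n0))) b" by (simp only: z funpow_add o_apply)
  then have "(\<omega> ^^ n2) z = b" by (simp only: m omega_pow_3)
  then have x: "x = b + fvec i2" using w(9) by simp
  have "a \<in> simplex_pts s" "b \<in> simplex_pts s" "x \<in> simplex_pts s"
    using w(1-3) y z by (auto simp: Q0_def omega_pow_simplex)
  moreover have "k mod 3 \<in> {0, 1, 2}" for k :: int by auto
  moreover have "path_A x [i0 + j0, i1 - j2, i2] =
      [(x, (i0 + j0) mod 3), (a, (i1 - j2) mod 3), (b, i2 mod 3)]"
    by (simp add: a_def b_def)
  moreover have "verts (quiver_A s) = simplex_pts s" "tail (quiver_A s) = fst"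
    "head (quiver_A s) = (\<lambda>(x, i). x + fvec i)" "arcs (quiver_A s) =
      {(x, i). i \<in> {0, 1, 2} \<and> x \<in> simplex_pts s \<and> x + fvec i \<in> simplex_pts s}"
    by (simp_all add: quiver_A_def)
  ultimately have "A.awalk x (path_A x [i0 + j0, i1 - j2, i2]) x"
    by (simp add: A.awalk_def f_mod a_def[symmetric] b_def[symmetric] x[symmetric] del: path_A.simps insert_iff)
  then show ?thesis unfolding A.closed_w_def by (intro exI[of _ x] conjI) simp_all
qed

end

theory Submission
  imports Defs
begin

text \<open>
  The two potentials differ only by a rescaling of the arrows. If \<open>\<phi>\<close> assigns a nonzero number to each
  arrow and the coefficient of every cycle in \<open>V\<close> is its coefficient in \<open>W\<close> times the product of \<open>\<phi>\<close>
  over the cycle, then the automorphism \<open>a \<mapsto> \<phi>(a) a\<close> of the path algebra sends each \<open>\<partial>\<^sub>a W\<close> to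
  \<open>\<phi>(a)\<^bsup>-1\<^esup> \<partial>\<^sub>a V\<close>. It therefore carries one Jacobian ideal onto the other and induces an isomorphism of
  the Jacobian algebras (\<open>jacobian_algebra_rescale\<close>).

  It remains to find \<open>\<phi>\<close>. In type A, the quantum numbers satisfy \<open>[s + 2 - n] = [n]\<close>, which turns the
  radicand of \<open>\<mu>\<^sub>A\<close> into a product of three terms \<open>[m] [m + 1]\<close>, one for each arrow of the 3-cycle, with
  \<open>m\<close> the coordinate that the arrow decreases. So
  \<open>\<phi>(e\<^sub>x \<alpha>\<^sub>0) = (-1)\<^bsup>x1+s\<^esup> sqrt ([x\<^sub>0] [x\<^sub>0 + 1]) / [2]\<^bsup>1/3\<^esup>\<close>, extended to all arrows by the rotational symmetry
  of the quiver, has the product \<open>\<mu>\<^sub>A\<close> on cycles \<open>\<alpha>\<^sub>0 \<alpha>\<^sub>1 \<alpha>\<^sub>2\<close> and \<open>-\<mu>\<^sub>A\<close> on cycles \<open>\<alpha>\<^sub>0 \<alpha>\<^sub>2 \<alpha>\<^sub>1\<close>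
  (\<open>mu_A_closed\<close>).

  Being invariant under rotation, these weights descend to the arrows \<open>e\<^sub>x \<alpha>\<^bsub>i,j\<^esub>\<close> of type D. A 3-cycle of
  type D that counts in the potentials lifts to a 3-cycle of type A with the same weight, and the
  lift is fixed by the rotation exactly if the cycle is the cube of a loop
  (\<open>rot_A_cycle_fixed_iff\<close>); this accounts for the factors \<open>1/3\<close> in both potentials. Finally, for
  \<open>s = 3 t + 1\<close> the two cycles through each copy of the centre impose two conditions on the product
  \<open>\<phi>(\<beta>\<^sub>k) \<phi>(\<gamma>\<^sub>k)\<close>, which agree in modulus, and in phase since \<open>\<zeta>\<^sup>3 = 1\<close> (\<open>mu_D_lambda_D_Beta\<close>).
\<close>

section \<open>Rescaling the arrows of a quiver with potential\<close>

text \<open>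
  An isomorphism that carries \<open>I\<close> onto \<open>J\<close> carries the cosets of \<open>I\<close> onto the cosets of \<open>J\<close>,
  so the induced map on quotients is simply the direct image of cosets.
\<close>

lemma ring_iso_image_quotient:
  assumes "ring A" "ring B" and h: "h \<in> ring_iso A B"
    and I: "ideal I A" and J: "ideal J B" and IJ: "h ` I = J"
  shows "(`) h \<in> ring_iso (A Quot I) (B Quot J)"
    and "x \<in> carrier A \<Longrightarrow> h ` (I +>\<^bsub>A\<^esub> x) = J +>\<^bsub>B\<^esub> h x"
proof -
  interpret A: ring A by fact
  interpret B: ring B by fact
  interpret I: ideal I A by fact
  interpret J: ideal J B by fact
  note hE = ring_iso_memE[OF h]
  have coset: "h ` (I +>\<^bsub>A\<^esub> x) = J +>\<^bsub>B\<^esub> h x" if "x \<in> carrier A" for x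
  proof -
    have "h ` (I +>\<^bsub>A\<^esub> x) = (\<lambda>k. h (k \<oplus>\<^bsub>A\<^esub> x)) ` I"
      by (auto simp: a_r_coset_def')
    also have "\<dots> = (\<lambda>k. h k \<oplus>\<^bsub>B\<^esub> h x) ` I"
      by (intro image_cong refl) (simp add: hE(3) that)
    also have "\<dots> = J +>\<^bsub>B\<^esub> h x"
      by (auto simp: a_r_coset_def' IJ[symmetric])
    finally show ?thesis .
  qed
  then show "x \<in> carrier A \<Longrightarrow> h ` (I +>\<^bsub>A\<^esub> x) = J +>\<^bsub>B\<^esub> h x" .
  have carrI: "carrier (A Quot I) = (+>\<^bsub>A\<^esub>) I ` carrier A"
    by (auto simp: FactRing_simps)
  have carrJ: "carrier (B Quot J) = (+>\<^bsub>B\<^esub>) J ` carrier B"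
    by (auto simp: FactRing_simps)
  show "(`) h \<in> ring_iso (A Quot I) (B Quot J)"
  proof (rule ring_iso_memI)
    fix X Y assume "X \<in> carrier (A Quot I)" "Y \<in> carrier (A Quot I)"
    then obtain x y where xy: "x \<in> carrier A" "y \<in> carrier A" "X = I +>\<^bsub>A\<^esub> x" "Y = I +>\<^bsub>A\<^esub> y"
      by (auto simp: carrI)
    show "h ` X \<in> carrier (B Quot J)" using xy by (simp add: coset carrJ hE(1))
    show "h ` (X \<otimes>\<^bsub>A Quot I\<^esub> Y) = h ` X \<otimes>\<^bsub>B Quot J\<^esub> h ` Y"
      using xy by (simp add: FactRing_def I.rcoset_mult_add J.rcoset_mult_add coset hE)
    show "h ` (X \<oplus>\<^bsub>A Quot I\<^esub> Y) = h ` X \<oplus>\<^bsub>B Quot J\<^esub> h ` Y"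
      using xy by (simp add: FactRing_def I.a_rcos_sum J.a_rcos_sum coset hE)
  next
    show "h ` \<one>\<^bsub>A Quot I\<^esub> = \<one>\<^bsub>B Quot J\<^esub>" by (simp add: FactRing_def coset hE)
    show "bij_betw ((`) h) (carrier (A Quot I)) (carrier (B Quot J))"
    proof (rule bij_betw_imageI)
      have "h ` carrier A = carrier B" using hE(5) by (simp add: bij_betw_def)
      then have "carrier (B Quot J) = (\<lambda>x. J +>\<^bsub>B\<^esub> h x) ` carrier A"
        by (simp only: carrJ image_image flip: \<open>h ` carrier A = carrier B\<close>)
      also have "\<dots> = (\<lambda>x. h ` (I +>\<^bsub>A\<^esub> x)) ` carrier A"
        by (intro image_cong refl) (simp only: coset)
      finally show "(`) h ` carrier (A Quot I) = carrier (B Quot J)"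
        by (simp only: carrI image_image)
      have "carrier (A Quot I) \<subseteq> Pow (carrier A)"
        using A.a_r_coset_subset_G[OF I.a_subset] by (auto simp: carrI)
      moreover have "inj_on ((`) h) (Pow (carrier A))"
        using hE(5) by (intro inj_on_image_Pow) (simp add: bij_betw_def)
      ultimately show "inj_on ((`) h) (carrier (A Quot I))" by (rule inj_on_subset[rotated])
    qed
  qed
qed

text \<open>
  The endomorphism of the path algebra that fixes the trivial paths and multiplies every arrow
  \<open>a\<close> by \<open>\<phi> a\<close>. It acts on each path separately, hence on all finitely supported functions on paths.
\<close>

definition rescale :: "('a \<Rightarrow> complex) \<Rightarrow> (('v, 'a) qpath \<Rightarrow>\<^sub>0 complex) \<Rightarrow> (('v, 'a) qpath \<Rightarrow>\<^sub>0 complex)"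
  where "rescale \<phi> = Poly_Mapping.mapp (\<lambda>p c. prod_list (map \<phi> (snd p)) * c)"

lemma lookup_rescale:
  "Poly_Mapping.lookup (rescale \<phi> f) p = prod_list (map \<phi> (snd p)) * Poly_Mapping.lookup f p"
  by (simp add: rescale_def lookup_mapp when_def in_keys_iff)

lemma rescale_zero [simp]: "rescale \<phi> 0 = 0"
  and rescale_add: "rescale \<phi> (f + g) = rescale \<phi> f + rescale \<phi> g"
  and rescale_smult: "rescale \<phi> (path_smult c f) = path_smult c (rescale \<phi> f)"
  and rescale_single:
    "rescale \<phi> (Poly_Mapping.single p c) = Poly_Mapping.single p (prod_list (map \<phi> (snd p)) * c)"
  by (auto simp: lookup_rescale lookup_add lookup_path_smult lookup_single when_def algebra_simps
      intro!: poly_mapping_eqI)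

lemma rescale_sum: "rescale \<phi> (sum F A) = (\<Sum>x\<in>A. rescale \<phi> (F x))"
  by (induction A rule: infinite_finite_induct) (auto simp: rescale_add)

lemma keys_rescale: "Poly_Mapping.keys (rescale \<phi> f) \<subseteq> Poly_Mapping.keys f"
  by (auto simp: in_keys_iff lookup_rescale)

lemma rescale_mult: "rescale \<phi> (path_mult G f g) = path_mult G (rescale \<phi> f) (rescale \<phi> g)"
proof (induction f rule: poly_mapping_single_induct)
  case (single p a)
  show ?case
    by (induction g rule: poly_mapping_single_induct)
       (simp_all add: path_mult_single rescale_single rescale_add path_mult_add_right ac_simps)
qed (simp_all add: rescale_add path_mult_add_left)

lemma (in wf_digraph) arcs_of_qpath: "p \<in> qpaths G \<Longrightarrow> set (snd p) \<subseteq> arcs G"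
  by (auto simp: qpaths_def awalk_def)

lemma (in wf_digraph) rescale_inverse:
  assumes "\<forall>a\<in>arcs G. \<phi> a * \<psi> a = 1" and "Poly_Mapping.keys f \<subseteq> qpaths G"
  shows "rescale \<phi> (rescale \<psi> f) = f"
proof (rule poly_mapping_eqI)
  fix p
  have "prod_list (map \<phi> q) * prod_list (map \<psi> q) = 1" if "set q \<subseteq> arcs G" for q
    using that
  proof (induction q)
    case (Cons a q)
    then have "\<phi> a * \<psi> a = 1" using assms(1) by simp
    then have "\<phi> a * (prod_list (map \<phi> q) * prod_list (map \<psi> q)) * \<psi> a = 1"
      using Cons by simp
    then show ?case by (simp add: ac_simps)
  qed simp
  moreover have "set (snd p) \<subseteq> arcs G" if "p \<in> Poly_Mapping.keys f"
    using that assms(2) arcs_of_qpath by blast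
  ultimately show "Poly_Mapping.lookup (rescale \<phi> (rescale \<psi> f)) p = Poly_Mapping.lookup f p"
    by (cases "p \<in> Poly_Mapping.keys f") (simp_all add: lookup_rescale in_keys_iff mult.assoc[symmetric])
qed

lemma (in fin_digraph) rescale_ring_iso:
  assumes "\<forall>a\<in>arcs G. \<phi> a \<noteq> 0"
  shows "rescale \<phi> \<in> ring_iso (path_algebra G) (path_algebra G)"
proof (rule ring_iso_memI)
  let ?A = "path_algebra G"
  show "rescale \<phi> f \<in> carrier ?A" if "f \<in> carrier ?A" for f
    using that keys_rescale by (fastforce simp: path_algebra_def)
  show "rescale \<phi> \<one>\<^bsub>?A\<^esub> = \<one>\<^bsub>?A\<^esub>"
    by (simp add: path_algebra_def rescale_sum rescale_single)
  show "bij_betw (rescale \<phi>) (carrier ?A) (carrier ?A)"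
    using keys_rescale assms
    by (intro bij_betw_byWitness[where f' = "rescale (\<lambda>a. 1 / \<phi> a)"])
       (fastforce simp: path_algebra_def intro!: rescale_inverse)+
qed (simp_all add: path_algebra_def rescale_mult rescale_add)

lemma path_smult_sum: "path_smult c (sum F A) = (\<Sum>x\<in>A. path_smult c (F x))"
  by (induction A rule: infinite_finite_induct) auto

text \<open>
  Deleting one occurrence of \<open>a\<close> from the cycle \<open>p\<close> leaves a path whose weight is that of \<open>p\<close>
  without one factor \<open>\<phi> a\<close>. Stating this with \<open>\<phi> a\<close> multiplied back avoids a division.
\<close>

lemma rescale_cycle_deriv:
  "path_smult (\<phi> a) (rescale \<phi> (cycle_deriv G a p)) =
    path_smult (prod_list (map \<phi> p)) (cycle_deriv G a p)"
proof -
  have "\<phi> a * prod_list (map \<phi> (drop (Suc i) p @ take i p)) = prod_list (map \<phi> p)"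
    if "i < length p" "p ! i = a" for i
    by (subst (3) id_take_nth_drop[OF that(1)]) (simp add: that ac_simps)
  then show ?thesis
    unfolding cycle_deriv_def
    by (auto simp: rescale_sum rescale_single path_smult_sum intro!: sum.cong)
qed

lemma path_smult_smult: "path_smult c (path_smult d f) = path_smult (c * d) f"
  by (rule poly_mapping_eqI) (simp add: lookup_path_smult)

lemma prod_list_rotate:
  fixes \<phi> :: "'a \<Rightarrow> complex"
  shows "prod_list (map \<phi> (rotate n p)) = prod_list (map \<phi> p)"
proof (induction n)
  case (Suc n)
  have "prod_list (map \<phi> (rotate1 q)) = prod_list (map \<phi> q)" for q
    by (cases q) simp_all
  with Suc show ?case by simp
qed simp

text \<open>
  If the coefficients of \<open>V\<close> are those of \<open>W\<close> times the weights of the cycles, then rescaling sends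
  \<open>\<partial>\<^sub>a W\<close> to a multiple of \<open>\<partial>\<^sub>a V\<close>. The weight of a cycle is the same for all its rotations, so
  it does not matter which representative is differentiated.
\<close>

lemma rescale_potential_deriv:
  assumes "Poly_Mapping.keys W \<subseteq> range cyc" "Poly_Mapping.keys V \<subseteq> range cyc"
    and V: "\<And>p. cyc p \<in> Poly_Mapping.keys W \<union> Poly_Mapping.keys V \<Longrightarrow>
      Poly_Mapping.lookup V (cyc p) = Poly_Mapping.lookup W (cyc p) * prod_list (map \<phi> p)"
  shows "path_smult (\<phi> a) (rescale \<phi> (potential_deriv G a W)) = potential_deriv G a V"
proof -
  have keys: "Poly_Mapping.keys V \<subseteq> Poly_Mapping.keys W"
  proof
    fix c assume c: "c \<in> Poly_Mapping.keys V"
    with assms(2) obtain p where "c = cyc p" by auto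
    with c V[of p] show "c \<in> Poly_Mapping.keys W" by (auto simp: in_keys_iff)
  qed
  have "path_smult (\<phi> a) (rescale \<phi> (path_smult (Poly_Mapping.lookup W c) (cycle_deriv G a (SOME p. p \<in> c))))
      = path_smult (Poly_Mapping.lookup V c) (cycle_deriv G a (SOME p. p \<in> c))"
    if c: "c \<in> Poly_Mapping.keys W" for c
  proof -
    from c assms(1) obtain p where p: "c = cyc p" by auto
    then have "p \<in> c" by (auto simp: cyc_def intro: range_eqI[of _ _ 0])
    then have "(SOME p. p \<in> c) \<in> c" by (rule someI)
    then obtain n where n: "(SOME p. p \<in> c) = rotate n p" by (auto simp: p cyc_def)
    have "Poly_Mapping.lookup V c = Poly_Mapping.lookup W c * prod_list (map \<phi> p)"
      using V c by (simp add: p)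
    moreover have "path_smult (\<phi> a) (rescale \<phi> (path_smult w (cycle_deriv G a (rotate n p))))
      = path_smult w (path_smult (\<phi> a) (rescale \<phi> (cycle_deriv G a (rotate n p))))" for w
      by (simp add: rescale_smult path_smult_smult mult.commute)
    ultimately show ?thesis
      unfolding n by (simp add: rescale_cycle_deriv prod_list_rotate path_smult_smult)
  qed
  then have "path_smult (\<phi> a) (rescale \<phi> (potential_deriv G a W)) =
      (\<Sum>c\<in>Poly_Mapping.keys W.
        path_smult (Poly_Mapping.lookup V c) (cycle_deriv G a (SOME p. p \<in> c)))"
    unfolding potential_deriv_def by (simp add: rescale_sum path_smult_sum)
  also have "\<dots> = potential_deriv G a V"
    unfolding potential_deriv_def
    by (intro sum.mono_neutral_right keys) (auto simp: in_keys_iff lookup_path_smult intro!: poly_mapping_eqI)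
  finally show ?thesis .
qed

context fin_digraph
begin

text \<open>
  Scalars act as multiples of the identity of the path algebra, hence ring ideals are
  automatically subspaces.
\<close>

lemma ideal_smult:
  assumes "ideal I (path_algebra G)" "f \<in> I"
  shows "path_smult c f \<in> I"
proof -
  interpret I: ideal I "path_algebra G" by fact
  let ?one = "\<Sum>v\<in>verts G. Poly_Mapping.single (v, []) 1"
  have "path_smult c ?one \<in> carrier (path_algebra G)"
    using I.one_closed by (simp add: path_algebra_def path_smult_closed)
  from I.I_l_closed[OF assms(2) this] have "path_mult G (path_smult c ?one) f \<in> I"
    by (simp add: path_algebra_def)
  moreover have "Poly_Mapping.keys f \<subseteq> qpaths G"
    using I.a_Hcarr[OF assms(2)] by (simp add: path_algebra_def)
  ultimately show ?thesis by (simp add: path_mult_smult one_path_mult)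
qed

definition jacobian_ideal :: "'b potential \<Rightarrow> (('a, 'b) qpath \<Rightarrow>\<^sub>0 complex) set" where
  "jacobian_ideal W = Idl\<^bsub>path_algebra G\<^esub> ((\<lambda>a. potential_deriv G a W) ` arcs G)"

lemma ideal_jacobian_ideal:
  assumes "Poly_Mapping.keys W \<subseteq> {cyc p |p. closed_w p}"
  shows "ideal (jacobian_ideal W) (path_algebra G)"
  unfolding jacobian_ideal_def
  by (intro ring.genideal_ideal[OF ring_path_algebra] image_subsetI potential_deriv_closed[OF assms])

text \<open>
  The preimage of the second Jacobian ideal is an ideal that contains the generators of the
  first one, because these are sent to multiples of \<open>\<partial>\<^sub>a V\<close>.
\<close>

lemma rescale_jacobian_ideal:
  assumes keys: "Poly_Mapping.keys W \<subseteq> {cyc p |p. closed_w p}" "Poly_Mapping.keys V \<subseteq> {cyc p |p. closed_w p}"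
    and \<phi>: "\<forall>a\<in>arcs G. \<phi> a \<noteq> 0"
    and V: "\<And>p. cyc p \<in> Poly_Mapping.keys W \<union> Poly_Mapping.keys V \<Longrightarrow>
      Poly_Mapping.lookup V (cyc p) = Poly_Mapping.lookup W (cyc p) * prod_list (map \<phi> p)"
  shows "rescale \<phi> ` jacobian_ideal W \<subseteq> jacobian_ideal V"
proof -
  let ?A = "path_algebra G"
  let ?K = "{f \<in> carrier ?A. rescale \<phi> f \<in> jacobian_ideal V}"
  interpret A: ring ?A by (rule ring_path_algebra)
  note iso = ring_iso_memE[OF rescale_ring_iso[OF \<phi>]]
  have JV: "ideal (jacobian_ideal V) ?A" by (rule ideal_jacobian_ideal) fact
  have "rescale \<phi> \<in> ring_hom ?A ?A"
    using rescale_ring_iso[OF \<phi>] by (simp add: ring_iso_def)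
  then have "ring_hom_ring ?A ?A (rescale \<phi>)" by (intro ring_hom_ringI2 A.ring_axioms)
  then have K: "ideal ?K ?A"
    using ring_hom_ring.ideal_vimage[OF _ JV] by blast
  have "potential_deriv G a W \<in> ?K" if a: "a \<in> arcs G" for a
  proof -
    have "rescale \<phi> (potential_deriv G a W) = path_smult (1 / \<phi> a) (potential_deriv G a V)"
      using keys \<phi> a by (subst rescale_potential_deriv[OF _ _ V, symmetric])
        (auto simp: path_smult_smult lookup_path_smult intro!: poly_mapping_eqI)
    moreover have "potential_deriv G a V \<in> jacobian_ideal V"
      unfolding jacobian_ideal_def
      by (rule subsetD[OF A.genideal_self]) (use a keys potential_deriv_closed in auto)
    ultimately show ?thesis
      using ideal_smult[OF JV] potential_deriv_closed[OF keys(1)] by simp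
  qed
  then have "jacobian_ideal W \<subseteq> ?K"
    unfolding jacobian_ideal_def[of W] by (intro A.genideal_minimal K) auto
  then show ?thesis by auto
qed

text \<open>
  The inverse rescaling turns \<open>V\<close> back into \<open>W\<close>, so the inclusion of Jacobian ideals holds in both
  directions and rescaling descends to an isomorphism of the quotients.
\<close>

theorem jacobian_algebra_rescale:
  assumes keys: "Poly_Mapping.keys W \<subseteq> {cyc p |p. closed_w p}" "Poly_Mapping.keys V \<subseteq> {cyc p |p. closed_w p}"
    and \<phi>: "\<forall>a\<in>arcs G. \<phi> a \<noteq> 0"
    and V: "\<And>p. closed_w p \<Longrightarrow>
      Poly_Mapping.lookup V (cyc p) = Poly_Mapping.lookup W (cyc p) * prod_list (map \<phi> p)"
  shows "jacobian_algebra G W \<cong>\<^sub>a jacobian_algebra G V"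
proof -
  let ?A = "path_algebra G" and ?\<psi> = "\<lambda>a. 1 / \<phi> a"
  have closed: "closed_w p" if "cyc p \<in> Poly_Mapping.keys W \<union> Poly_Mapping.keys V" for p
  proof -
    from that keys obtain q where q: "cyc p = cyc q" "closed_w q" by auto
    have "p \<in> cyc p" by (auto simp: cyc_def intro: range_eqI[of _ _ 0])
    then obtain n where "p = rotate n q" unfolding q(1) by (auto simp: cyc_def)
    then show ?thesis using closed_w_rotate q(2) by simp
  qed
  have W: "Poly_Mapping.lookup W (cyc p) = Poly_Mapping.lookup V (cyc p) * prod_list (map ?\<psi> p)"
    if "closed_w p" for p
  proof -
    have "prod_list (map \<phi> q) * prod_list (map ?\<psi> q) = 1" if "set q \<subseteq> arcs G" for q
      using that by (induction q) (use \<phi> in auto)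
    moreover have "set p \<subseteq> arcs G" using that by (auto simp: closed_w_def awalk_def)
    ultimately show ?thesis using V[OF that] by simp
  qed
  have JW: "ideal (jacobian_ideal W) ?A" and JV: "ideal (jacobian_ideal V) ?A"
    by (rule ideal_jacobian_ideal, fact)+
  have image: "rescale \<phi> ` jacobian_ideal W = jacobian_ideal V"
  proof
    show "rescale \<phi> ` jacobian_ideal W \<subseteq> jacobian_ideal V"
      using V closed by (intro rescale_jacobian_ideal keys \<phi>) blast
    have sub: "rescale ?\<psi> ` jacobian_ideal V \<subseteq> jacobian_ideal W"
      using \<phi> W closed by (intro rescale_jacobian_ideal keys) auto
    show "jacobian_ideal V \<subseteq> rescale \<phi> ` jacobian_ideal W"
    proof
      fix f assume f: "f \<in> jacobian_ideal V"
      then have "Poly_Mapping.keys f \<subseteq> qpaths G"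
        using ideal.Icarr[OF JV] by (auto simp: path_algebra_def)
      then have "f = rescale \<phi> (rescale ?\<psi> f)"
        using \<phi> by (intro rescale_inverse[symmetric]) auto
      with sub f show "f \<in> rescale \<phi> ` jacobian_ideal W" by blast
    qed
  qed
  let ?QW = "quotient_algebra ?A (jacobian_ideal W)"
  let ?QV = "quotient_algebra ?A (jacobian_ideal V)"
  note quot = ring_iso_image_quotient[OF ring_path_algebra ring_path_algebra
      rescale_ring_iso[OF \<phi>] JW JV image]
  have "(`) (rescale \<phi>) \<in> ring_iso ?QW ?QV"
    using quot(1)
    by (simp add: ring_iso_def ring_hom_def quotient_algebra_def ring.extend_def module.fields_def)
  moreover have "rescale \<phi> ` (c \<odot>\<^bsub>?QW\<^esub> X) = c \<odot>\<^bsub>?QV\<^esub> (rescale \<phi> ` X)"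
    if "X \<in> carrier ?QW" for c X
  proof -
    from that obtain f where f: "f \<in> carrier ?A" "X = jacobian_ideal W +>\<^bsub>?A\<^esub> f"
      by (auto simp: quotient_algebra_def ring.extend_def FactRing_simps)
    moreover have "c \<odot>\<^bsub>?A\<^esub> f \<in> carrier ?A" "rescale \<phi> f \<in> carrier ?A"
      using f(1) path_smult_closed ring_iso_memE(1)[OF rescale_ring_iso[OF \<phi>]]
      by (auto simp: path_algebra_def)
    moreover have "rescale \<phi> (c \<odot>\<^bsub>?A\<^esub> f) = c \<odot>\<^bsub>?A\<^esub> rescale \<phi> f"
      by (simp add: path_algebra_def rescale_smult)
    ultimately show ?thesis
      by (simp add: quotient_smult[OF JW] quotient_smult[OF JV] quot(2))
  qed
  ultimately show ?thesis
    unfolding is_algebra_iso_def jacobian_algebra_def jacobian_ideal_def[symmetric] algebra_iso_def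
    by blast
qed

end

section \<open>Arrow weights in type A\<close>

text \<open>
  The quantum numbers are the real numbers \<open>sin (n \<pi> / (s + 2)) / sin (\<pi> / (s + 2))\<close>. In this form
  their positivity and the symmetry \<open>[s + 2 - n] = [n]\<close> are evident.
\<close>

definition rnum :: "int \<Rightarrow> int \<Rightarrow> real" where
  "rnum s n = sin (pi * of_int n / of_int (s + 2)) / sin (pi / of_int (s + 2))"

lemma qnum_eq_rnum: "qnum s n = complex_of_real (rnum s n)"
proof -
  define x where "x = pi / of_int (s + 2)"
  have q: "qroot s = exp (\<i> * complex_of_real x)"
    by (simp add: qroot_def x_def mult.commute)
  have powi: "qroot s powi k = cis (of_int k * x)" for k
  proof -
    have "qroot s = cis x" by (simp only: q cis_conv_exp)
    then show ?thesis by (simp add: cis_power_int)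
  qed
  have "qroot s powi k - qroot s powi (- k) = 2 * \<i> * complex_of_real (sin (of_int k * x))" for k
    unfolding powi by (simp add: complex_eq_iff)
  from this[of n] this[of 1] show ?thesis
    by (simp add: qnum_def rnum_def x_def mult.commute)
qed

lemma rnum_nonneg: "0 \<le> n \<Longrightarrow> n \<le> s + 2 \<Longrightarrow> 0 \<le> rnum s n"
  and rnum_pos: "0 < n \<Longrightarrow> n < s + 2 \<Longrightarrow> 0 < rnum s n"
proof -
  have arg: "pi * of_int n / of_int (s + 2) = pi * (of_int n / of_int (s + 2))" for n
    by simp
  have nonneg: "0 \<le> sin (pi * of_int n / of_int (s + 2))" if "0 \<le> n" "n \<le> s + 2" for n
  proof -
    have "of_int n / of_int (s + 2) \<le> (1 :: real)" using that by (cases "s + 2 = 0") (auto simp: divide_le_eq_1)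
    then have "pi * (of_int n / of_int (s + 2)) \<le> pi"
      using pi_ge_zero by (rule mult_left_le)
    moreover have "0 \<le> of_int n / (of_int (s + 2) :: real)" using that by (intro divide_nonneg_nonneg) linarith+
    ultimately show ?thesis unfolding arg by (intro sin_ge_zero mult_nonneg_nonneg pi_ge_zero)
  qed
  have pos: "0 < sin (pi * of_int n / of_int (s + 2))" if "0 < n" "n < s + 2" for n
  proof -
    have "of_int n / of_int (s + 2) < (1 :: real)" using that by (subst divide_less_eq_1_pos) linarith+
    then have "pi * (of_int n / of_int (s + 2)) < pi * 1"
      using pi_gt_zero by (intro mult_strict_left_mono)
    then show ?thesis unfolding arg using that by (intro sin_gt_zero mult_pos_pos) auto
  qed
  show "0 \<le> n \<Longrightarrow> n \<le> s + 2 \<Longrightarrow> 0 \<le> rnum s n"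
    using nonneg[of n] nonneg[of 1] unfolding rnum_def
    by (cases "n = 0") (auto intro!: divide_nonneg_nonneg)
  show "0 < n \<Longrightarrow> n < s + 2 \<Longrightarrow> 0 < rnum s n"
    using pos[of n] pos[of 1] unfolding rnum_def by (auto intro!: divide_pos_pos)
qed

lemma rnum_reflect: "s \<ge> 0 \<Longrightarrow> rnum s (s + 2 - n) = rnum s n"
proof -
  assume "s \<ge> 0"
  then have "pi * of_int (s + 2 - n) / of_int (s + 2) = pi - pi * of_int n / of_int (s + 2)"
    by (simp add: field_simps)
  then have "sin (pi * of_int (s + 2 - n) / of_int (s + 2)) = sin (pi * of_int n / of_int (s + 2))"
    using sin_pi_minus[of "pi * of_int n / of_int (s + 2)"] by (rule ssubst)
  then show ?thesis by (simp only: rnum_def)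
qed

text \<open>
  The weight of the arrow \<open>e\<^sub>x \<alpha>\<^sub>0\<close>. Because \<open>[s + 2 - n] = [n]\<close>, each radicand of \<open>\<mu>\<^sub>A\<close> splits into three
  factors \<open>[m] [m + 1]\<close>, one for each arrow of the 3-cycle, where \<open>m\<close> is the coordinate that
  the arrow decreases. The denominator \<open>[2]\<close> is shared equally among the three arrows. The sign is
  chosen so that the product over \<open>\<alpha>\<^sub>0 \<alpha>\<^sub>1 \<alpha>\<^sub>2\<close> is positive and over \<open>\<alpha>\<^sub>0 \<alpha>\<^sub>2 \<alpha>\<^sub>1\<close> negative: the
  exponents \<open>x\<^sub>1 + s\<close> of the three arrows add up to \<open>4 s - 2\<close> and to \<open>4 s - 3\<close>, respectively.
\<close>

fun weight0 :: "int \<Rightarrow> triple \<Rightarrow> real" where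
  "weight0 s (x0, x1, x2) =
    (if even (x1 + s) then 1 else - 1) * sqrt (rnum s x0 * rnum s (x0 + 1)) / root 3 (rnum s 2)"

lemma omega_pow_mod: "(\<omega> ^^ (n mod 3)) x = (\<omega> ^^ n) x"
proof -
  have "(\<omega> ^^ n) x = (\<omega> ^^ (n mod 3 + 3 * (n div 3))) x" by simp
  then show ?thesis by (simp only: funpow_add o_apply omega_pow_3)
qed

text \<open>
  Since \<open>\<omega>\<close> has order 3, it has integer powers; negative ones occur when lifting cycles of type D.
\<close>

definition omega_int :: "int \<Rightarrow> triple \<Rightarrow> triple" where
  "omega_int k = \<omega> ^^ nat (k mod 3)"

lemma omega_int_cong: "k mod 3 = l mod 3 \<Longrightarrow> omega_int k = omega_int l"
  by (simp add: omega_int_def)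

lemma omega_int_simps [simp]:
  "omega_int 0 x = x" "omega_int 1 x = \<omega> x" "omega_int 2 x = \<omega> (\<omega> x)"
  "omega_int (k mod 3) x = omega_int k x"
  by (simp_all add: omega_int_def numeral_2_eq_2)

lemma omega_int_add: "omega_int (k + l) x = omega_int k (omega_int l x)"
proof -
  have "int (nat ((k + l) mod 3)) = int ((nat (k mod 3) + nat (l mod 3)) mod 3)"
    by (simp add: zmod_int mod_add_eq)
  then have "nat ((k + l) mod 3) = (nat (k mod 3) + nat (l mod 3)) mod 3"
    by (simp only: of_nat_eq_iff)
  then show ?thesis by (simp only: omega_int_def omega_pow_mod funpow_add o_apply)
qed

lemma omega_int_plus: "omega_int k (x + y) = omega_int k x + omega_int k y"
  by (simp add: omega_int_def omega_pow_add)

lemma fvec_cong: "k mod 3 = l mod 3 \<Longrightarrow> fvec k = fvec l"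
  by (simp add: fvec_def)

lemma fvec_mod [simp]: "fvec (k mod 3) = fvec k"
  by (simp add: fvec_def)

lemma omega_int_fvec: "omega_int k (fvec i) = fvec (i - k)"
  by (auto simp: omega_int_def omega_pow_fvec mod_simps intro!: fvec_cong)

lemma omega_int_simplex: "omega_int k x \<in> simplex_pts s \<longleftrightarrow> x \<in> simplex_pts s"
  by (simp add: omega_int_def omega_pow_simplex)

text \<open>
  The other arrows get their weights from the rotation \<open>e\<^sub>x \<alpha>\<^sub>i \<mapsto> e\<^bsub>\<omega>(x)\<^esub> \<alpha>\<^bsub>i-1\<^esub>\<close>, which takes
  \<open>e\<^sub>x \<alpha>\<^sub>i\<close> to \<open>e\<^bsub>\<omega>^i(x)\<^esub> \<alpha>\<^sub>0\<close>. Invariance under rotation lets the weights descend to type D.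
\<close>

definition weight_A :: "int \<Rightarrow> triple \<times> int \<Rightarrow> complex" where
  "weight_A s = (\<lambda>(x, i). complex_of_real (weight0 s (omega_int i x)))"

lemma weight_A_mod [simp]: "weight_A s (x, i mod 3) = weight_A s (x, i)"
  by (simp add: weight_A_def)

lemma weight_A_omega_int: "weight_A s (omega_int k x, i) = weight_A s (x, i + k)"
  by (simp add: weight_A_def omega_int_add)

text \<open>
  The last two factors of the radicand are rewritten by \<open>[s + 2 - n] = [n]\<close> as \<open>[x\<^sub>0 + 1] [x\<^sub>0]\<close>,
  and then each pair of factors is the square of one arrow weight up to sign and \<open>[2]\<close>.
\<close>

lemma weight_012:
  assumes "s \<ge> 2" "x \<in> simplex_pts s" "x + fvec 0 \<in> simplex_pts s"
  shows "prod_list (map (weight_A s) (path_A x [0, 1, 2])) = mu012 s x"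
proof -
  obtain x0 x1 x2 where x: "x = (x0, x1, x2)" by (cases x)
  have le: "0 < x0" "0 \<le> x1" "0 \<le> x2" "x0 + x1 + x2 = s - 1"
    using assms(2,3) by (auto simp: simplex_pts_def x fvec_def)
  define r where "r = root 3 (rnum s 2)"
  have r: "r * r * r = rnum s 2" using odd_real_root_pow[of 3 "rnum s 2"]
    by (simp add: r_def power3_eq_cube)
  \<comment> \<open>The reflection \<open>[s + 2 - n] = [n]\<close> at \<open>n = x\<^sub>0 + 1\<close> and \<open>n = x\<^sub>0\<close>, as \<open>x\<^sub>1 + x\<^sub>2 = s - 1 - x\<^sub>0\<close>.\<close>
  have sh: "rnum s (x1 + x2 + 2) = rnum s (x0 + 1)" "rnum s (x1 + x2 + 3) = rnum s x0"
  proof -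
    have "x1 + x2 + 2 = s + 2 - (x0 + 1)" "x1 + x2 + 3 = s + 2 - x0" using le(4) by simp_all
    then show "rnum s (x1 + x2 + 2) = rnum s (x0 + 1)" "rnum s (x1 + x2 + 3) = rnum s x0"
      using assms(1) by (simp_all only: rnum_reflect)
  qed
  let ?P = "rnum s (x1 + 1) * rnum s (x1 + 2) * rnum s (x2 + 1) * rnum s (x2 + 2)
           * rnum s (x1 + x2 + 2) * rnum s (x1 + x2 + 3)"
  have nn: "?P \<ge> 0"
    using assms(1) le by (intro mult_nonneg_nonneg rnum_nonneg) auto
  have "mu012 s x = complex_of_real (sqrt ?P / rnum s 2)"
    using csqrt_of_real_nonneg[of "complex_of_real ?P"] nn by (simp add: x qnum_eq_rnum)
  also have "sqrt ?P / rnum s 2 = weight0 s x * weight0 s (\<omega> (x + fvec 0)) * weight0 s (\<omega> (\<omega> (x + fvec 0 + fvec 1)))"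
  proof -
    have "even (x1 + s) \<longleftrightarrow> (even (x2 + s) \<longleftrightarrow> even (x0 - 1 + s))"
      using le(4) by presburger
    then have "weight0 s x * weight0 s (\<omega> (x + fvec 0)) * weight0 s (\<omega> (\<omega> (x + fvec 0 + fvec 1)))
      = sqrt (rnum s x0 * rnum s (x0 + 1)) * sqrt (rnum s (x1 + 1) * rnum s (x1 + 2))
        * sqrt (rnum s (x2 + 1) * rnum s (x2 + 2)) / (r * r * r)"
      by (auto simp: x fvec_def r_def add.commute)
    then show ?thesis
      by (simp only: r sh real_sqrt_mult) (simp add: ac_simps)
  qed
  finally show ?thesis
    by (simp add: weight_A_def numeral_2_eq_2 mult.assoc)
qed

lemma weight_021:
  assumes "s \<ge> 2" "x \<in> simplex_pts s" "x + fvec 0 \<in> simplex_pts s" "x + fvec 0 + fvec 2 \<in> simplex_pts s"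
  shows "prod_list (map (weight_A s) (path_A x [0, 2, 1])) = - mu021 s x"
proof -
  obtain x0 x1 x2 where x: "x = (x0, x1, x2)" by (cases x)
  have le: "0 < x0" "0 \<le> x1" "0 < x2" "x0 + x1 + x2 = s - 1"
    using assms(2-4) by (auto simp: simplex_pts_def x fvec_def)
  define r where "r = root 3 (rnum s 2)"
  have r: "r * r * r = rnum s 2" using odd_real_root_pow[of 3 "rnum s 2"]
    by (simp add: r_def power3_eq_cube)
  \<comment> \<open>The reflection \<open>[s + 2 - n] = [n]\<close> at \<open>n = x\<^sub>0 + 1\<close> and \<open>n = x\<^sub>0\<close>, as \<open>x\<^sub>1 + x\<^sub>2 = s - 1 - x\<^sub>0\<close>.\<close>
  have sh: "rnum s (x1 + x2 + 2) = rnum s (x0 + 1)" "rnum s (x1 + x2 + 3) = rnum s x0"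
  proof -
    have "x1 + x2 + 2 = s + 2 - (x0 + 1)" "x1 + x2 + 3 = s + 2 - x0" using le(4) by simp_all
    then show "rnum s (x1 + x2 + 2) = rnum s (x0 + 1)" "rnum s (x1 + x2 + 3) = rnum s x0"
      using assms(1) by (simp_all only: rnum_reflect)
  qed
  let ?P = "rnum s (x1 + 1) * rnum s (x1 + 2) * rnum s x2 * rnum s (x2 + 1)
           * rnum s (x1 + x2 + 2) * rnum s (x1 + x2 + 3)"
  have nn: "?P \<ge> 0"
    using assms(1) le by (intro mult_nonneg_nonneg rnum_nonneg) auto
  have "mu021 s x = complex_of_real (sqrt ?P / rnum s 2)"
    using csqrt_of_real_nonneg[of "complex_of_real ?P"] nn by (simp add: x qnum_eq_rnum)
  also have "sqrt ?P / rnum s 2 = - (weight0 s x * weight0 s (\<omega> (\<omega> (x + fvec 0))) * weight0 s (\<omega> (x + fvec 0 + fvec 2)))"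
  proof -
    have "even (x1 + s) \<longleftrightarrow> (even (x0 - 1 + s) \<longleftrightarrow> odd (x2 - 1 + s))"
      using le(4) by presburger
    then have "weight0 s x * weight0 s (\<omega> (\<omega> (x + fvec 0))) * weight0 s (\<omega> (x + fvec 0 + fvec 2))
      = - (sqrt (rnum s x0 * rnum s (x0 + 1)) * sqrt (rnum s x2 * rnum s (x2 + 1))
        * sqrt (rnum s (x1 + 1) * rnum s (x1 + 2)) / (r * r * r))"
      by (auto simp: x fvec_def r_def add.commute)
    then show ?thesis
      by (simp only: r sh real_sqrt_mult) (simp add: ac_simps)
  qed
  finally show ?thesis
    by (simp add: weight_A_def numeral_2_eq_2 mult.assoc)
qed

lemma quiver_A_sel:
  "verts (quiver_A s) = simplex_pts s" "tail (quiver_A s) = fst"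
  "arcs (quiver_A s) = {(x, i). i \<in> {0, 1, 2} \<and> x \<in> simplex_pts s \<and> x + fvec i \<in> simplex_pts s}"
  "head (quiver_A s) = (\<lambda>(x, i). x + fvec i)"
  by (simp_all add: quiver_A_def)

lemma quiver_D_sel:
  "verts (quiver_D s) = Vtx ` Q0 s \<union> Copy ` copies s" "tail (quiver_D s) = tail_D s"
  "arcs (quiver_D s) = Q1 s \<union> Beta ` copies s \<union> Gamma ` copies s"
  "head (quiver_D s) = head_D s"
  by (simp_all add: quiver_D_def)

lemma closed_w_A_3:
  assumes "wf_digraph.closed_w (quiver_A s) (path_A x [i, j, k])"
  shows "x \<in> simplex_pts s" "x + fvec i \<in> simplex_pts s" "x + fvec i + fvec j \<in> simplex_pts s"
    "x + fvec i + fvec j + fvec k = x"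
proof -
  interpret A: fin_digraph "quiver_A s" by (rule fin_digraph_quiver_A)
  show "x \<in> simplex_pts s" "x + fvec i \<in> simplex_pts s" "x + fvec i + fvec j \<in> simplex_pts s"
    "x + fvec i + fvec j + fvec k = x"
    using assms by (auto simp: A.closed_w_def A.awalk_Cons_iff A.awalk_Nil_iff quiver_A_sel)
qed

lemma path_A_mod: "path_A x (map (\<lambda>i. i mod 3) is) = path_A x is"
  by (induction "is" arbitrary: x) simp_all

text \<open>
  Up to multiples, the only linear relation among the \<open>f\<^sub>i\<close> is that they sum to zero, so a 3-cycle of type A
  uses each index once, in one of the two cyclic orders.
\<close>

lemma closed_indices_A:
  assumes "fvec i + fvec j + fvec k = 0"
  obtains (cw) "mod3 (i, j, k) \<in> {(0, 1, 2), (1, 2, 0), (2, 0, 1)}"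
  | (ccw) "mod3 (i, j, k) \<in> {(0, 2, 1), (2, 1, 0), (1, 0, 2)}"
proof -
  have r: "l mod 3 = 0 \<or> l mod 3 = 1 \<or> l mod 3 = 2" for l :: int by presburger
  show thesis
    using assms r[of i] r[of j] r[of k] that
    by (auto simp: fvec_def zero_prod_def split: if_splits)
qed

text \<open>
  Both \<open>\<mu>\<^sub>A\<close> and the product of the weights are invariant under rotation of the cycle, so the cycle may
  be assumed to begin with \<open>\<alpha>\<^sub>0\<close>. The conclusion also records which orientation the indices have, which
  is the information that \<open>\<lambda>\<^sub>D\<close> depends on.
\<close>

lemma mu_A_closed:
  assumes s: "s \<ge> 2" and closed: "wf_digraph.closed_w (quiver_A s) (path_A x [i, j, k])"
  defines "m \<equiv> mu_A s (cyc (path_A x [i, j, k]))"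
    and "w \<equiv> prod_list (map (weight_A s) (path_A x [i, j, k]))"
  shows "mod3 (i, j, k) \<sim> (0, 1, 2) \<and> \<not> mod3 (i, j, k) \<sim> (0, 2, 1) \<and> m = w \<or>
    \<not> mod3 (i, j, k) \<sim> (0, 1, 2) \<and> mod3 (i, j, k) \<sim> (0, 2, 1) \<and> m = - w"
proof -
  note c = closed_w_A_3[OF closed]
  have sum0: "fvec i + fvec j + fvec k = 0" using c(4) by (simp add: add.assoc)
  have mods: "path_A x [i, j, k] = path_A x [i mod 3, j mod 3, k mod 3]"
    using path_A_mod[of x "[i, j, k]"] by simp
  from sum0 show ?thesis
  proof (cases rule: closed_indices_A)
    case cw
    then consider "i mod 3 = 0" "j mod 3 = 1" "k mod 3 = 2" | "i mod 3 = 1" "j mod 3 = 2" "k mod 3 = 0"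
      | "i mod 3 = 2" "j mod 3 = 0" "k mod 3 = 1" by auto
    then have "\<exists>y. cyc (path_A x [i, j, k]) = cyc (path_A y [0, 1, 2]) \<and>
        w = prod_list (map (weight_A s) (path_A y [0, 1, 2])) \<and>
        y \<in> simplex_pts s \<and> y + fvec 0 \<in> simplex_pts s"
    proof cases
      case 1
      then have "fvec i = fvec 0" by (simp add: fvec_def)
      with 1 c show ?thesis by (intro exI[of _ x]) (auto simp: mods w_def simp del: path_A.simps)
    next
      case 2
      then have "fvec i = fvec 1" "fvec j = fvec 2" "fvec k = fvec 0" by (simp_all add: fvec_def)
      with 2 c show ?thesis
        by (intro exI[of _ "x + fvec i + fvec j"]) (auto simp: w_def cyc_3_eq_iff ac_simps)
    next
      case 3
      then have "fvec i = fvec 2" "fvec j = fvec 0" "fvec k = fvec 1" by (simp_all add: fvec_def)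
      with 3 c show ?thesis
        by (intro exI[of _ "x + fvec i"]) (auto simp: w_def cyc_3_eq_iff ac_simps)
    qed
    then obtain y where y: "cyc (path_A x [i, j, k]) = cyc (path_A y [0, 1, 2])"
      "w = prod_list (map (weight_A s) (path_A y [0, 1, 2]))"
      "y \<in> simplex_pts s" "y + fvec 0 \<in> simplex_pts s" by blast
    have "m = w" unfolding m_def y(1,2) mu_A_simps weight_012[OF s y(3,4)] ..
    moreover have "u \<sim> (0, 1, 2) \<and> \<not> u \<sim> (0, 2, 1)" if "u \<in> {(0, 1, 2), (1, 2, 0), (2, 0, 1)}" for u
      using that by (elim insertE emptyE) (simp_all add: cyc_equiv_def)
    from this[OF cw] have "mod3 (i, j, k) \<sim> (0, 1, 2) \<and> \<not> mod3 (i, j, k) \<sim> (0, 2, 1)" .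
    ultimately show ?thesis by blast
  next
    case ccw
    then consider "i mod 3 = 0" "j mod 3 = 2" "k mod 3 = 1" | "i mod 3 = 2" "j mod 3 = 1" "k mod 3 = 0"
      | "i mod 3 = 1" "j mod 3 = 0" "k mod 3 = 2" by auto
    then have "\<exists>y. cyc (path_A x [i, j, k]) = cyc (path_A y [0, 2, 1]) \<and>
        w = prod_list (map (weight_A s) (path_A y [0, 2, 1])) \<and>
        y \<in> simplex_pts s \<and> y + fvec 0 \<in> simplex_pts s \<and> y + fvec 0 + fvec 2 \<in> simplex_pts s"
    proof cases
      case 1
      then have "fvec i = fvec 0" "fvec j = fvec 2" by (simp_all add: fvec_def)
      with 1 c show ?thesis by (intro exI[of _ x]) (auto simp: mods w_def simp del: path_A.simps)
    next
      case 2
      then have "fvec i = fvec 2" "fvec j = fvec 1" "fvec k = fvec 0" by (simp_all add: fvec_def)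
      with 2 c show ?thesis
        by (intro exI[of _ "x + fvec i + fvec j"]) (auto simp: w_def cyc_3_eq_iff ac_simps)
    next
      case 3
      then have "fvec i = fvec 1" "fvec j = fvec 0" "fvec k = fvec 2" by (simp_all add: fvec_def)
      with 3 c show ?thesis
        by (intro exI[of _ "x + fvec i"]) (auto simp: w_def cyc_3_eq_iff ac_simps)
    qed
    then obtain y where y: "cyc (path_A x [i, j, k]) = cyc (path_A y [0, 2, 1])"
      "w = prod_list (map (weight_A s) (path_A y [0, 2, 1]))"
      "y \<in> simplex_pts s" "y + fvec 0 \<in> simplex_pts s" "y + fvec 0 + fvec 2 \<in> simplex_pts s" by blast
    have "m = - w" unfolding m_def y(1,2) mu_A_simps weight_021[OF s y(3-5)] by simp
    moreover have "\<not> u \<sim> (0, 1, 2) \<and> u \<sim> (0, 2, 1)" if "u \<in> {(0, 2, 1), (2, 1, 0), (1, 0, 2)}" for u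
      using that by (elim insertE emptyE) (simp_all add: cyc_equiv_def)
    from this[OF ccw] have "\<not> mod3 (i, j, k) \<sim> (0, 1, 2) \<and> mod3 (i, j, k) \<sim> (0, 2, 1)" .
    ultimately show ?thesis by blast
  qed
qed

section \<open>Lifting 3-cycles from type D to type A\<close>

lemma image_cyc: "map f ` cyc p = cyc (map f p)"
  by (simp add: cyc_def image_image rotate_map)

lemma card_orbit_A:
  fixes d
  defines "R \<equiv> (`) (map rot_A)"
  assumes "R (R (R d)) = d"
  shows "card (orbit_A d) = (if R d = d then 1 else 3)"
proof -
  have pow3: "(R ^^ (3 * m)) d = d" for m
    by (induction m) (simp_all add: numeral_3_eq_3 assms(2))
  have "(R ^^ n) d \<in> {d, R d, R (R d)}" for n
  proof -
    have "(R ^^ n) d = (R ^^ (n mod 3 + 3 * (n div 3))) d" by simp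
    also have "\<dots> = (R ^^ (n mod 3)) d" by (simp only: funpow_add o_apply pow3)
    finally have n: "(R ^^ n) d = (R ^^ (n mod 3)) d" .
    have "n mod 3 = 0 \<or> n mod 3 = 1 \<or> n mod 3 = 2" by presburger
    then show ?thesis unfolding n by (elim disjE) (simp_all add: numeral_2_eq_2)
  qed
  moreover have "d = (R ^^ 0) d" "R d = (R ^^ 1) d" "R (R d) = (R ^^ 2) d"
    by (simp_all add: numeral_2_eq_2)
  ultimately have "orbit_A d = {d, R d, R (R d)}"
    unfolding orbit_A_def R_def[symmetric] by blast
  moreover have "d \<noteq> R (R d)" "R d \<noteq> R (R d)" if "d \<noteq> R d" using that assms(2) by metis+
  ultimately show ?thesis by (cases "d = R d") simp_all
qed

lemma fvec_inj: "fvec i = fvec j \<Longrightarrow> {i, j} \<subseteq> {0, 1, 2} \<Longrightarrow> i = j"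
  by (auto simp: fvec_def)

text \<open>
  The vertices in \<open>Q\<^sub>0\<close> are strictly larger than their rotations, so an orbit of \<open>\<omega>\<close> contains at most
  one of them, and its stabiliser is trivial.
\<close>

lemma Q0_rotation_unique:
  assumes "x \<in> Q0 s" "omega_int k x \<in> Q0 s" shows "k mod 3 = 0"
proof -
  obtain x0 x1 x2 where x: "x = (x0, x1, x2)" by (cases x)
  have "k mod 3 = 0 \<or> k mod 3 = 1 \<or> k mod 3 = 2" by presburger
  then consider "k mod 3 = 0" | "omega_int k = omega_int 1" | "omega_int k = omega_int 2"
    using omega_int_cong[of k 1] omega_int_cong[of k 2] by auto
  then show ?thesis
    using assms by cases (auto simp: x Q0_def lex_greater_def)
qed

lemma closed_w_D_Alpha:
  assumes "wf_digraph.closed_w (quiver_D s) [Alpha x i0 j0, Alpha y i1 j1, Alpha z i2 j2]"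
  shows "x \<in> Q0 s" "y \<in> Q0 s" "z \<in> Q0 s" "{i0, i1, i2, j0, j1, j2} \<subseteq> {0, 1, 2}"
    "y = omega_int j0 x + fvec i0" "z = omega_int j1 y + fvec i1" "x = omega_int j2 z + fvec i2"
proof -
  interpret D: fin_digraph "quiver_D s" by (rule fin_digraph_quiver_D)
  have w: "Alpha x i0 j0 \<in> Q1 s" "Alpha y i1 j1 \<in> Q1 s" "Alpha z i2 j2 \<in> Q1 s"
    "y = (\<omega> ^^ nat j0) x + fvec i0" "z = (\<omega> ^^ nat j1) y + fvec i1" "x = (\<omega> ^^ nat j2) z + fvec i2"
    using assms by (auto simp: D.closed_w_def D.awalk_Cons_iff D.awalk_Nil_iff quiver_D_sel)
  have Q1: "v \<in> Q0 s \<and> i \<in> {0, 1, 2} \<and> j \<in> {0, 1, 2}" if "Alpha v i j \<in> Q1 s" for v i j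
    using that by (auto simp: Q1_def)
  show "x \<in> Q0 s" "y \<in> Q0 s" "z \<in> Q0 s" "{i0, i1, i2, j0, j1, j2} \<subseteq> {0, 1, 2}"
    using Q1[OF w(1)] Q1[OF w(2)] Q1[OF w(3)] by blast+
  have "(\<omega> ^^ nat j) = omega_int j" if "j \<in> {0, 1, 2}" for j
    using that by (auto simp: omega_int_def)
  then show "y = omega_int j0 x + fvec i0" "z = omega_int j1 y + fvec i1" "x = omega_int j2 z + fvec i2"
    using w(4-6) Q1[OF w(1)] Q1[OF w(2)] Q1[OF w(3)] by simp_all
qed

text \<open>
  A 3-cycle \<open>e\<^sub>x \<alpha>\<^bsub>i0,j0\<^esub> \<alpha>\<^bsub>i1,j1\<^esub> \<alpha>\<^bsub>i2,j2\<^esub>\<close> of type D with \<open>j\<^sub>0 + j\<^sub>1 + j\<^sub>2 \<equiv> 0\<close> lifts to the 3-cycle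
  \<open>e\<^sub>x \<alpha>\<^bsub>i0+j0\<^esub> \<alpha>\<^bsub>i1-j2\<^esub> \<alpha>\<^bsub>i2\<^esub>\<close> of type A. Its vertices are rotations of those of the cycle of type D;
  the total rotation along the cycle is trivial, so \<open>\<omega>\<^bsup>j0+j1\<^esup> = \<omega>\<^bsup>-j2\<^esup>\<close>.
\<close>

lemma lifted_vertices:
  assumes "wf_digraph.closed_w (quiver_D s) [Alpha x i0 j0, Alpha y i1 j1, Alpha z i2 j2]"
    and j: "(j0 + j1 + j2) mod 3 = 0"
  shows "y = omega_int j0 (x + fvec (i0 + j0))"
    and "z = omega_int (- j2) (x + fvec (i0 + j0) + fvec (i1 - j2))"
proof -
  note w = closed_w_D_Alpha[OF assms(1)]
  show y: "y = omega_int j0 (x + fvec (i0 + j0))"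
    using w(5) by (simp add: omega_int_plus omega_int_fvec)
  have "(j1 + j0) mod 3 = (- j2) mod 3" using j by presburger
  then have "omega_int j1 y = omega_int (- j2) (x + fvec (i0 + j0))"
    unfolding y omega_int_add[symmetric] by (rule omega_int_cong[THEN fun_cong])
  moreover have "omega_int (- j2) (fvec (i1 - j2)) = fvec i1" by (simp add: omega_int_fvec)
  ultimately show "z = omega_int (- j2) (x + fvec (i0 + j0) + fvec (i1 - j2))"
    using w(6) by (simp only: omega_int_plus[of _ "x + fvec (i0 + j0)"])
qed

text \<open>
  By invariance under rotation, each arrow of the lift has the weight of the arrow that lies over
  the same arrow \<open>e\<^sub>y \<alpha>\<^bsub>i,j\<^esub>\<close> and starts in \<open>Q\<^sub>0\<close>, namely \<open>e\<^sub>y \<alpha>\<^bsub>i+j\<^esub>\<close>.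
\<close>

lemma weight_lift:
  assumes "wf_digraph.closed_w (quiver_D s) [Alpha x i0 j0, Alpha y i1 j1, Alpha z i2 j2]"
    and j: "(j0 + j1 + j2) mod 3 = 0"
  shows "prod_list (map (weight_A s) (path_A x [i0 + j0, i1 - j2, i2])) =
    weight_A s (x, i0 + j0) * weight_A s (y, i1 + j1) * weight_A s (z, i2 + j2)"
proof -
  from j have "3 dvd - (j0 + j1 + j2)" by (simp only: dvd_minus_iff mod_eq_0_iff_dvd)
  then have e: "(i1 - j2) mod 3 = (i1 + j1 + j0) mod 3"
    by (simp add: mod_eq_dvd_iff algebra_simps)
  have "weight_A s (v, i1 - j2) = weight_A s (v, i1 + j1 + j0)" for v
    by (simp only: weight_A_def prod.case omega_int_cong[OF e])
  then show ?thesis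
    by (simp add: lifted_vertices[OF assms] weight_A_omega_int mult.assoc)
qed

text \<open>
  If rotation fixes the lifted cycle, it permutes its three arrows cyclically, as it changes their
  indices. Then the three vertices form one orbit of \<open>\<omega>\<close> and lie over the same vertex of \<open>Q\<^sub>0\<close>, so the cycle
  of type D stays at one vertex; comparing the differences \<open>f\<^sub>i\<close> shows that it repeats one loop.
  Conversely, for a loop the relations between the vertices exhibit the rotated cycle as a
  rotation of the list of arrows.
\<close>

lemma rot_A_cycle_fixed_iff:
  assumes w: "wf_digraph.closed_w (quiver_D s) [Alpha x i0 j0, Alpha y i1 j1, Alpha z i2 j2]"
    and j: "(j0 + j1 + j2) mod 3 = 0"
  shows "map rot_A ` cyc (path_A x [i0 + j0, i1 - j2, i2]) = cyc (path_A x [i0 + j0, i1 - j2, i2])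
    \<longleftrightarrow> Alpha x i0 j0 = Alpha y i1 j1 \<and> Alpha y i1 j1 = Alpha z i2 j2"
    (is "?fixed \<longleftrightarrow> ?loop")
proof -
  note c = closed_w_D_Alpha[OF w] and v = lifted_vertices[OF w j]
  have wA: "wf_digraph.closed_w (quiver_A s) (path_A x [i0 + j0, i1 - j2, i2])"
    using w j by (rule closed_w_lift)
  define a b where "a = x + fvec (i0 + j0)" and "b = a + fvec (i1 - j2)"
  have y: "y = omega_int j0 a" and z: "z = omega_int (- j2) b"
    using v by (simp_all add: a_def b_def)
  have path: "path_A x [i0 + j0, i1 - j2, i2] =
      [(x, (i0 + j0) mod 3), (a, (i1 - j2) mod 3), (b, i2 mod 3)]"
    by (simp add: a_def b_def)
  \<comment> \<open>Equality of the two cycles means that the rotated list is one of the three rotations of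
    the original list; the first of them is excluded by the indices.\<close>
  have rot: "?fixed \<longleftrightarrow>
     [(\<omega> x, ((i0 + j0) mod 3 - 1) mod 3), (\<omega> a, ((i1 - j2) mod 3 - 1) mod 3), (\<omega> b, (i2 mod 3 - 1) mod 3)]
     \<in> {[(x, (i0 + j0) mod 3), (a, (i1 - j2) mod 3), (b, i2 mod 3)],
        [(a, (i1 - j2) mod 3), (b, i2 mod 3), (x, (i0 + j0) mod 3)],
        [(b, i2 mod 3), (x, (i0 + j0) mod 3), (a, (i1 - j2) mod 3)]}"
    unfolding path image_cyc by (simp only: list.map rot_A_def prod.case cyc_3_eq_iff)
  have jr: "j0 \<in> {0, 1, 2}" "j1 \<in> {0, 1, 2}" "j2 \<in> {0, 1, 2}" using c(4) by simp_all
  have omega3: "\<omega> (\<omega> (\<omega> u)) = u" for u by (cases u) simp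
  show ?thesis
  proof
    assume ?fixed
    have "(i0 + j0) mod 3 \<noteq> ((i0 + j0) mod 3 - 1) mod 3"
      by (simp add: mod_simps mod_eq_dvd_iff)
    moreover from \<open>?fixed\<close>[unfolded rot] have "((i0 + j0) mod 3 - 1) mod 3 = (i0 + j0) mod 3 \<or>
        a = \<omega> x \<and> b = \<omega> a \<or> b = \<omega> x \<and> x = \<omega> a"
      by (simp only: insert_iff empty_iff list.inject prod.inject) blast
    ultimately consider "a = \<omega> x" "b = \<omega> a" | "b = \<omega> x" "x = \<omega> a" by metis
    then have "j0 = j1 \<and> j1 = j2 \<and> y = x \<and> z = x"
    proof cases
      case 1
      have yz: "y = omega_int (j0 + 1) x" "z = omega_int (2 - j2) x"
        using omega_int_add[of j0 1 x] omega_int_add[of "- j2" 2 x] by (simp_all add: y z 1)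
      note Q0_rotation_unique[OF c(1) c(2)[unfolded yz(1)]] Q0_rotation_unique[OF c(1) c(3)[unfolded yz(2)]]
      then have j02: "j0 = 2" "j2 = 2" using jr(1,3) by auto
      moreover have "j1 = 2" using j jr(2) by (auto simp: j02)
      ultimately show ?thesis using omega_int_cong[of 3 0] by (simp add: yz)
    next
      case 2
      then have a: "a = omega_int 2 x" using omega3[of a] by simp
      have yz: "y = omega_int (j0 + 2) x" "z = omega_int (1 - j2) x"
        using omega_int_add[of j0 2 x] omega_int_add[of "- j2" 1 x] by (simp_all add: y z a 2(1))
      note Q0_rotation_unique[OF c(1) c(2)[unfolded yz(1)]] Q0_rotation_unique[OF c(1) c(3)[unfolded yz(2)]]
      then have j02: "j0 = 1" "j2 = 1" using jr(1,3) by auto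
      moreover have "j1 = 1" using j jr(2) by (auto simp: j02)
      ultimately show ?thesis using omega_int_cong[of 3 0] by (simp add: yz)
    qed
    moreover from this have "fvec i0 = fvec i1" "fvec i1 = fvec i2"
      using c(5-7) by (metis add_left_cancel)+
    ultimately show ?loop using fvec_inj c(4) by auto
  next
    assume ?loop
    then have eq: "y = x" "z = x" "i1 = i0" "i2 = i0" "j1 = j0" "j2 = j0" by auto
    have "fvec (i0 + j0) + fvec (i1 - j2) + fvec i2 = 0"
      using closed_w_A_3(4)[OF wA] by (simp add: add.assoc)
    \<comment> \<open>For \<open>j0 = 0\<close> all three indices of the lifted cycle would be equal.\<close>
    then have "j0 \<noteq> 0" by (cases rule: closed_indices_A) (auto simp: eq)
    then consider "j0 = 1" | "j0 = 2" using jr(1) by auto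
    then show ?fixed
    proof cases
      case 1
      have "omega_int (- 1) b = omega_int 2 b" by (intro omega_int_cong[THEN fun_cong]) simp
      then have "x = \<omega> a" "x = \<omega> (\<omega> b)" using y z by (simp_all add: eq 1)
      then have "\<omega> x = b" "\<omega> b = a" using omega3 by metis+
      moreover have "((i0 + 1) mod 3 - 1) mod 3 = i0 mod 3" "((i0 - 1) mod 3 - 1) mod 3 = (i0 + 1) mod 3"
        "(i0 mod 3 - 1) mod 3 = (i0 - 1) mod 3" by (simp_all add: mod_simps mod_eq_dvd_iff)
      ultimately show ?thesis unfolding rot unfolding eq 1 using \<open>x = \<omega> a\<close>[symmetric]
        by (simp only: insert_iff simp_thms)
    next
      case 2
      have "omega_int (- 2) b = omega_int 1 b" by (intro omega_int_cong[THEN fun_cong]) simp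
      then have "x = \<omega> (\<omega> a)" "x = \<omega> b" using y z by (simp_all add: eq 2)
      then have "\<omega> x = a" "\<omega> a = b" using omega3 by metis+
      moreover have "((i0 + 2) mod 3 - 1) mod 3 = (i0 - 2) mod 3" "((i0 - 2) mod 3 - 1) mod 3 = i0 mod 3"
        "(i0 mod 3 - 1) mod 3 = (i0 + 2) mod 3" by (simp_all add: mod_simps mod_eq_dvd_iff)
      ultimately show ?thesis unfolding rot unfolding eq 2 using \<open>x = \<omega> b\<close>[symmetric]
        by (simp only: insert_iff simp_thms)
    qed
  qed
qed

lemma rot_A_cycle_order3:
  "map rot_A ` map rot_A ` map rot_A ` cyc (path_A x is) = cyc (path_A x is)"
proof -
  have "rot_A (rot_A (rot_A (y, i mod 3))) = (y, i mod 3)" for y i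
  proof -
    have "(((i mod 3 - 1) mod 3 - 1) mod 3 - 1) mod 3 = i mod 3" by (simp add: mod_simps)
    then show ?thesis by (cases y) (simp add: rot_A_def)
  qed
  then have "map rot_A (map rot_A (map rot_A (path_A x is))) = path_A x is"
    by (induction "is" arbitrary: x) simp_all
  then show ?thesis by (simp only: image_cyc)
qed

text \<open>
  Two equal arrows in a 3-cycle are cyclically consecutive, hence a loop, and the third arrow is a
  loop at the same vertex. The condition on the \<open>j\<close> forces its second index to agree, and then
  its first index does as well because both loops have the same displacement.
\<close>

lemma repeated_arrow_loop:
  assumes w: "wf_digraph.closed_w (quiver_D s) [Alpha x i0 j0, Alpha y i1 j1, Alpha z i2 j2]"
    and j: "(j0 + j1 + j2) mod 3 = 0"
    and nd: "\<not> distinct [Alpha x i0 j0, Alpha y i1 j1, Alpha z i2 j2]"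
  shows "Alpha x i0 j0 = Alpha y i1 j1 \<and> Alpha y i1 j1 = Alpha z i2 j2"
proof -
  note c = closed_w_D_Alpha[OF w]
  have third: "l = k" if "(k + k + l) mod 3 = 0" "{k, l} \<subseteq> {0, 1, 2}" for k l :: int
    using that by auto
  from nd consider "x = y" "i0 = i1" "j0 = j1" | "y = z" "i1 = i2" "j1 = j2" | "x = z" "i0 = i2" "j0 = j2"
    by auto
  then have "x = y \<and> y = z \<and> j0 = j1 \<and> j1 = j2"
  proof cases
    case 1
    with c(5,6) third[of j0 j2] j c(4) show ?thesis by simp
  next
    case 2
    with c(6,7) third[of j1 j0] j c(4) show ?thesis by (simp add: add.commute)
  next
    case 3
    with c(5,7) third[of j0 j1] j c(4) show ?thesis by (simp add: ac_simps)
  qed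
  moreover from this have "fvec i0 = fvec i1" "fvec i1 = fvec i2"
    using c(5-7) by (metis add_left_cancel)+
  ultimately show ?thesis using fvec_inj c(4) by auto
qed

text \<open>
  The lifted cycle has an orbit of size 1 or 3 according to whether the cycle is the cube of a loop.
  Hence the factor \<open>|\<int>\<^sub>3 d| / 3\<close> of \<open>\<mu>\<^sub>D\<close> is the absolute value of \<open>\<lambda>\<^sub>D\<close>, while the signs of
  \<open>\<lambda>\<^sub>D\<close> are those by which the products of weights differ from \<open>\<mu>\<^sub>A\<close>. Cycles with
  \<open>j\<^sub>0 + j\<^sub>1 + j\<^sub>2\<close> not divisible by 3 do not lift, and both coefficients are 0.
\<close>

lemma mu_D_lambda_D_Alpha:
  assumes s: "s \<ge> 2"
    and w: "wf_digraph.closed_w (quiver_D s) [Alpha x i0 j0, Alpha y i1 j1, Alpha z i2 j2]"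
  shows "mu_D_word s [Alpha x i0 j0, Alpha y i1 j1, Alpha z i2 j2] =
    lambda_D_word [Alpha x i0 j0, Alpha y i1 j1, Alpha z i2 j2] *
    (weight_A s (x, i0 + j0) * weight_A s (y, i1 + j1) * weight_A s (z, i2 + j2))"
proof (cases "(j0 + j1 + j2) mod 3 = 0")
  case False
  have no_loop: "\<not> (Alpha x i0 j0 = Alpha y i1 j1 \<and> Alpha y i1 j1 = Alpha z i2 j2)"
  proof
    assume "Alpha x i0 j0 = Alpha y i1 j1 \<and> Alpha y i1 j1 = Alpha z i2 j2"
    then have "(j0 + j1 + j2) mod 3 = (3 * j0) mod 3" by simp
    then show False using False by simp
  qed
  show ?thesis
    unfolding lambda_D_word.simps mu_D_word.simps Let_def
    by (simp only: False no_loop simp_thms if_True if_False if_cancel mult_zero_left)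
next
  case True
  let ?p = "path_A x [i0 + j0, i1 - j2, i2]"
  let ?D = "[Alpha x i0 j0, Alpha y i1 j1, Alpha z i2 j2]"
  let ?loop = "Alpha x i0 j0 = Alpha y i1 j1 \<and> Alpha y i1 j1 = Alpha z i2 j2"
  let ?W = "weight_A s (x, i0 + j0) * weight_A s (y, i1 + j1) * weight_A s (z, i2 + j2)"
  have card: "card (orbit_A (cyc ?p)) = (if ?loop then 1 else 3)"
    by (simp only: card_orbit_A[OF rot_A_cycle_order3] rot_A_cycle_fixed_iff[OF w True])
  have mu: "mu_D_word s ?D = mu_A s (cyc ?p) * of_nat (card (orbit_A (cyc ?p))) / 3"
    by (simp only: mu_D_word.simps Let_def True simp_thms if_False)
  have distinct: "distinct ?D \<longleftrightarrow> \<not> ?loop"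
  proof
    assume "\<not> ?loop"
    then show "distinct ?D" using repeated_arrow_loop[OF w True] by blast
  qed simp
  let ?u = "mod3 (i0 + j0, i1 - j2, i2)"
  have lambda: "lambda_D_word ?D = (if ?u \<sim> (0, 1, 2) then 1 else if ?u \<sim> (0, 2, 1) then - 1 else 0)
      * (if ?loop then 1 / 3 else 1)"
  proof -
    \<comment> \<open>Stated for arbitrary propositions, so that simplification does not expand the conditions.\<close>
    have "(if \<not> L then if S \<noteq> 0 then 0 else if P then 1 else if Q then - 1 else 0
        else if L then if P then 1 / 3 else if Q then - 1 / 3 else 0 else 0) =
        (if P then 1 else if Q then - 1 else 0) * (if L then 1 / 3 else (1 :: complex))"
      if "S = 0" for L P Q and S :: int using that by auto
    from this[OF True] show ?thesis unfolding lambda_D_word.simps Let_def distinct .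
  qed
  have sign: "?u \<sim> (0, 1, 2) \<and> mu_A s (cyc ?p) = ?W \<or>
      \<not> ?u \<sim> (0, 1, 2) \<and> ?u \<sim> (0, 2, 1) \<and> mu_A s (cyc ?p) = - ?W"
    using mu_A_closed[OF s closed_w_lift[OF w True]] unfolding weight_lift[OF w True] by blast
  have "M * of_nat (if L then 1 else 3) / 3 =
      (if P then 1 else if Q then - 1 else 0) * (if L then 1 / 3 else 1) * W"
    if "P \<and> M = W \<or> \<not> P \<and> Q \<and> M = - W" for L P Q and M W :: complex
    using that by auto
  from this[OF sign] show ?thesis unfolding mu card lambda .
qed

section \<open>Arrow weights in type D\<close>

text \<open>
  The arrow \<open>e\<^sub>x \<alpha>\<^bsub>i,j\<^esub>\<close> lifts to \<open>e\<^sub>x \<alpha>\<^bsub>i+j\<^esub>\<close> in type A and inherits its weight. The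
  arrows \<open>\<beta>\<^sub>k\<close> and \<open>\<gamma>\<^sub>k\<close> enter only through their product, which is determined by the coefficient of
  \<open>\<alpha>\<^sub>1 \<beta>\<^sub>k \<gamma>\<^sub>k\<close>, and all of the product is put on \<open>\<beta>\<^sub>k\<close>.
\<close>

fun weight_D :: "int \<Rightarrow> arrow_D \<Rightarrow> complex" where
  "weight_D s (Alpha x i j) = weight_A s (x, i + j)"
| "weight_D s (Beta k) = (let t = s div 3 in
    - (\<zeta> powi k) * complex_of_real (rnum s (t + 1) * sqrt (rnum s t * rnum s (t + 2)) /
        (sqrt 3 * root 3 (rnum s 2) ^ 2)))"
| "weight_D s (Gamma k) = 1"

lemma weight_D_nonzero:
  assumes s: "s \<ge> 2" and a: "a \<in> arcs (quiver_D s)"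
  shows "weight_D s a \<noteq> 0"
proof -
  have r2: "root 3 (rnum s 2) \<noteq> 0" using rnum_pos[of 2 s] s by simp
  show ?thesis
  proof (cases a)
    case (Alpha x i j)
    with a have arc: "x \<in> simplex_pts s" "(\<omega> ^^ nat j) x + fvec i \<in> simplex_pts s" "j \<in> {0, 1, 2}"
      by (auto simp: quiver_D_sel Q1_def Q0_def)
    have "(\<omega> ^^ nat j) x = omega_int j x" using arc(3) by (auto simp: omega_int_def)
    then have "omega_int i (omega_int j x + fvec i) \<in> simplex_pts s"
      using arc(2) by (simp add: omega_int_simplex)
    then have "omega_int (i + j) x + fvec 0 \<in> simplex_pts s"
      by (simp add: omega_int_plus omega_int_fvec omega_int_add)
    moreover have "omega_int (i + j) x \<in> simplex_pts s" using arc(1) by (simp add: omega_int_simplex)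
    moreover obtain u0 u1 u2 where u: "omega_int (i + j) x = (u0, u1, u2)"
      by (cases "omega_int (i + j) x")
    ultimately have "0 < u0" "u0 \<le> s - 1" by (auto simp: simplex_pts_def fvec_def)
    then have "0 < rnum s u0" "0 < rnum s (u0 + 1)" by (auto intro: rnum_pos)
    then show ?thesis using r2 by (simp add: Alpha weight_A_def u)
  next
    case (Beta k)
    with a obtain t where t: "t > 0" "s = 3 * t + 1"
      by (auto simp: quiver_D_sel Q1_def copies_def split: if_splits)
    then have "0 < rnum s t" "0 < rnum s (t + 1)" "0 < rnum s (t + 2)" "s div 3 = t"
      by (auto intro: rnum_pos)
    moreover have "\<zeta> \<noteq> 0" by (simp add: \<zeta>_def)
    ultimately show ?thesis using r2 by (simp add: Beta Let_def)
  qed simp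
qed

lemma zeta_cubed: "\<zeta> ^ 3 = 1"
proof -
  have "of_nat 3 * (2 * complex_of_real pi * \<i> / 3) = 2 * complex_of_real pi * \<i>" by simp
  then show ?thesis by (simp only: \<zeta>_def exp_two_pi_i exp_of_nat_mult[symmetric])
qed

text \<open>
  The weight of \<open>\<beta>\<^sub>k\<close> fits both cycles through \<open>X\<^sub>k\<close>: the moduli agree because \<open>\<alpha>\<^sub>1\<close> and \<open>\<alpha>\<^bsub>2,1\<^esub>\<close> have
  weights \<open>sqrt ([t] [t + 1])\<close> and \<open>- sqrt ([t + 1] [t + 2])\<close> up to the common denominator, and the phases
  agree because \<open>\<zeta>\<^bsup>-k\<^esup> = \<zeta>\<^bsup>2k\<^esup>\<close>.
\<close>

lemma mu_D_lambda_D_Beta: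
  assumes s: "s \<ge> 2" and w: "wf_digraph.closed_w (quiver_D s) [Alpha x i j, Beta k, Gamma l]"
  shows "mu_D_word s [Alpha x i j, Beta k, Gamma l] = lambda_D_word [Alpha x i j, Beta k, Gamma l] *
    (weight_D s (Alpha x i j) * weight_D s (Beta k) * weight_D s (Gamma l))"
proof -
  interpret D: fin_digraph "quiver_D s" by (rule fin_digraph_quiver_D)
  have k: "k \<in> copies s" and x: "x = centre s + fvec 2"
    using w by (auto simp: D.closed_w_def D.awalk_Cons_iff D.awalk_Nil_iff quiver_D_sel Q1_def)
  from k obtain t where t: "t > 0" "s = 3 * t + 1" by (auto simp: copies_def split: if_splits)
  have st: "s div 3 = t" using t by simp
  have x: "x = (t + 1, t, t - 1)" by (simp add: x centre_def st fvec_def)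
  define A B C r where "A = sqrt (rnum s t)" and "B = sqrt (rnum s (t + 1))"
    and "C = sqrt (rnum s (t + 2))" and "r = root 3 (rnum s 2)"
  have nn: "A \<ge> 0" "B \<ge> 0" "C \<ge> 0" and ABC: "rnum s t = A ^ 2" "rnum s (t + 1) = B ^ 2" "rnum s (t + 2) = C ^ 2"
    using t rnum_nonneg[of t s] rnum_nonneg[of "t + 1" s] rnum_nonneg[of "t + 2" s]
    by (simp_all add: A_def B_def C_def)
  have r: "rnum s 2 = r ^ 3" "r \<noteq> 0"
    using rnum_pos[of 2 s] s by (simp_all add: r_def odd_real_root_pow)
  have sq: "sqrt (u ^ 2 * v ^ 2) = u * v" if "u \<ge> 0" "v \<ge> 0" for u v :: real
    using that by (simp add: real_sqrt_mult)
  have csq: "csqrt (complex_of_real (u ^ 2)) = complex_of_real u" if "u \<ge> 0" for u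
    using csqrt_of_real_nonneg[of "complex_of_real (u ^ 2)"] that
    by (simp only: Re_complex_of_real Im_complex_of_real real_sqrt_abs abs_of_nonneg zero_le_power2 simp_thms)
  have beta: "weight_D s (Beta k) = - (\<zeta> powi k) * complex_of_real (B ^ 2 * (A * C) / (sqrt 3 * r ^ 2))"
    using nn by (simp add: Let_def st ABC sq flip: r_def)
  have csqrt3: "csqrt 3 = complex_of_real (sqrt 3)"
    using csqrt_of_real_nonneg[of 3] by simp
  have "qnum s (t + 1) ^ 3 * qnum s (t + 2) = complex_of_real ((B ^ 3 * C) ^ 2)"
    by (simp add: qnum_eq_rnum ABC power_mult_distrib flip: power_mult)
  then have c1: "csqrt (qnum s (t + 1) ^ 3 * qnum s (t + 2)) = complex_of_real (B ^ 3 * C)"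
    using nn by (simp only: csq mult_nonneg_nonneg zero_le_power)
  have "qnum s t * qnum s (t + 1) ^ 3 = complex_of_real ((B ^ 3 * A) ^ 2)"
    by (simp add: qnum_eq_rnum ABC power_mult_distrib flip: power_mult)
  then have c2: "csqrt (qnum s t * qnum s (t + 1) ^ 3) = complex_of_real (B ^ 3 * A)"
    using nn by (simp only: csq mult_nonneg_nonneg zero_le_power)
  consider "(i, j) = (1, 0)" | "(i, j) = (2, 1)" | "(i, j) \<noteq> (1, 0)" "(i, j) \<noteq> (2, 1)" by blast
  then show ?thesis
  proof cases
    case 1
    have "even (t - 1 + s)" using t by simp
    then have alpha: "weight_D s (Alpha x i j) = complex_of_real (A * B / r)"
      using 1 nn by (simp add: weight_A_def x ABC sq flip: r_def)
    then show ?thesis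
      unfolding mu_D_word.simps lambda_D_word.simps Let_def st c1 csqrt3 alpha beta weight_D.simps(3)
      unfolding qnum_eq_rnum ABC r(1)
      using 1 r(2) by (simp add: field_simps power2_eq_square power3_eq_cube)
  next
    case 2
    have "odd (t + s)" using t by simp
    moreover have "omega_int 3 = omega_int 0" by (rule omega_int_cong) simp
    moreover have "rnum s (2 + t) = C ^ 2" using ABC(3) by (simp add: add.commute)
    ultimately have alpha: "weight_D s (Alpha x i j) = complex_of_real (- (B * C / r))"
      using 2 nn by (simp add: weight_A_def x ABC sq flip: r_def)
    have "\<zeta> \<noteq> 0" by (simp add: \<zeta>_def)
    have "\<zeta> powi (- k) = \<zeta> powi (3 * k + - k)"
    proof -
      have "\<zeta> powi (3 * k) = 1" using zeta_cubed by (simp add: power_int_mult)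
      then show ?thesis using power_int_add[of \<zeta> "3 * k" "- k"] \<open>\<zeta> \<noteq> 0\<close> by (simp only: mult_1 simp_thms)
    qed
    also have "\<dots> = \<zeta> powi k * \<zeta> powi k"
      using \<open>\<zeta> \<noteq> 0\<close> by (simp flip: power_int_add)
    finally have zeta: "\<zeta> powi (- k) = \<zeta> powi k * \<zeta> powi k" .
    show ?thesis
      unfolding mu_D_word.simps lambda_D_word.simps Let_def st c2 csqrt3 alpha beta zeta weight_D.simps(3)
      unfolding qnum_eq_rnum ABC r(1)
      using 2 r(2) by (simp add: field_simps power2_eq_square power3_eq_cube)
  next
    case 3
    then show ?thesis
      unfolding mu_D_word.simps lambda_D_word.simps Let_def by (simp only: if_False mult_zero_left)
  qed
qed

text \<open>
  A closed walk that begins with an arrow other than some \<open>\<alpha>\<^bsub>i,j\<^esub>\<close> has coefficient 0 in both formulas, so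
  the identity holds for all closed walks of length 3.
\<close>

lemma mu_D_eq_lambda_D_weight:
  assumes s: "s \<ge> 2" and w: "wf_digraph.closed_w (quiver_D s) p" "length p = 3"
  shows "mu_D_word s p = lambda_D_word p * prod_list (map (weight_D s) p)"
proof -
  obtain a b c where p: "p = [a, b, c]"
    using w(2) by (auto simp: numeral_3_eq_3 length_Suc_conv)
  show ?thesis
  proof (cases "is_Alpha a \<and> (is_Alpha b \<and> is_Alpha c \<or> (\<exists>k l. b = Beta k \<and> c = Gamma l))")
    case True
    then obtain x i j where a: "a = Alpha x i j" by (cases a) auto
    from True consider (Alpha) "is_Alpha b" "is_Alpha c" | (Beta) k l where "b = Beta k" "c = Gamma l" by blast
    then show ?thesis
    proof cases
      case Alpha
      then obtain y i1 j1 z i2 j2 where "b = Alpha y i1 j1" "c = Alpha z i2 j2" by (cases b; cases c) auto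
      with mu_D_lambda_D_Alpha[OF s] w(1) show ?thesis
        by (simp add: p a mult.assoc del: mu_D_word.simps lambda_D_word.simps)
    next
      case Beta
      with mu_D_lambda_D_Beta[OF s] w(1) show ?thesis
        by (simp add: p a mult.assoc del: mu_D_word.simps lambda_D_word.simps weight_D.simps)
    qed
  next
    case False
    then have "mu_D_word s p = 0" "lambda_D_word p = 0"
      by (cases a; cases b; cases c; simp add: p)+
    then show ?thesis by simp
  qed
qed

text \<open>
  The arrows \<open>\<beta>\<^sub>k\<close> and \<open>\<gamma>\<^sub>l\<close> alternate between the copies of the centre and other vertices, so they alone
  cannot form a cycle of odd length.
\<close>

lemma alpha_rep_rotation:
  assumes "wf_digraph.closed_w (quiver_D s) p" "length p = 3"
  shows "\<exists>n. alpha_rep (cyc p) = rotate n p"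
proof -
  interpret D: fin_digraph "quiver_D s" by (rule fin_digraph_quiver_D)
  obtain a b c where p: "p = [a, b, c]"
    using assms(2) by (auto simp: numeral_3_eq_3 length_Suc_conv)
  have "head_D s a = tail_D s b" "head_D s b = tail_D s c" "head_D s c = tail_D s a"
    using assms(1) by (auto simp: p D.closed_w_def D.awalk_Cons_iff D.awalk_Nil_iff quiver_D_sel)
  note heads = this
  have other: "(\<exists>k. e = Beta k) \<or> (\<exists>k. e = Gamma k)" if "\<not> is_Alpha e" for e
    using that by (cases e) simp_all
  have False if "\<not> is_Alpha a" "\<not> is_Alpha b" "\<not> is_Alpha c"
    using other[OF that(1)] other[OF that(2)] other[OF that(3)] heads by (elim disjE exE) simp_all
  then have "is_Alpha a \<or> is_Alpha b \<or> is_Alpha c" by blast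
  moreover have "[a, b, c] \<in> cyc p" "[b, c, a] \<in> cyc p" "[c, a, b] \<in> cyc p"
    unfolding p mem_cyc_3 by (simp_all only: insert_iff simp_thms)
  ultimately have "\<exists>q. q \<in> cyc p \<and> is_Alpha (hd q)" by (metis list.sel(1))
  then have "alpha_rep (cyc p) \<in> cyc p" unfolding alpha_rep_def by (rule someI2_ex) simp
  then show ?thesis by (auto simp: cyc_def)
qed

theorem proposition4p8:
  fixes s :: int
  assumes "s \<ge> 2"
  shows "Pi_D s \<cong>\<^sub>a jacobian_algebra (quiver_D s) (V_D s)"
proof -
  interpret D: fin_digraph "quiver_D s" by (rule fin_digraph_quiver_D)
  let ?T = "three_cycles (quiver_D s)"
  have fin: "finite ?T" by (rule finite_three_cycles) (rule fin_digraph_quiver_D)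
  have W: "Poly_Mapping.lookup (W_D s) c = (if c \<in> ?T then lambda_D_word (alpha_rep c) else 0)"
    and V: "Poly_Mapping.lookup (V_D s) c = (if c \<in> ?T then mu_D_word s (alpha_rep c) else 0)" for c
    using fin by (simp_all add: W_D_def V_D_def lookup_sum lookup_single when_def)
  have "?T \<subseteq> {cyc p |p. D.closed_w p}" by (auto simp: three_cycles_def)
  then have keys: "Poly_Mapping.keys (W_D s) \<subseteq> {cyc p |p. D.closed_w p}"
    "Poly_Mapping.keys (V_D s) \<subseteq> {cyc p |p. D.closed_w p}"
    using keys_W_D_V_D[of s] by blast+
  have coeff: "Poly_Mapping.lookup (V_D s) (cyc p) =
      Poly_Mapping.lookup (W_D s) (cyc p) * prod_list (map (weight_D s) p)"
    if p: "D.closed_w p" for p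
  proof (cases "cyc p \<in> ?T")
    case True
    then obtain q where q: "cyc p = cyc q" "D.closed_w q" "length q = 3"
      by (auto simp: three_cycles_def)
    have "p \<in> cyc p" by (auto simp: cyc_def intro: range_eqI[of _ _ 0])
    then obtain m where m: "p = rotate m q" unfolding q(1) by (auto simp: cyc_def)
    obtain n where n: "alpha_rep (cyc q) = rotate n q" using alpha_rep_rotation[OF q(2,3)] ..
    have "mu_D_word s (rotate n q) = lambda_D_word (rotate n q) * prod_list (map (weight_D s) (rotate n q))"
      using q(2,3) by (intro mu_D_eq_lambda_D_weight assms D.closed_w_rotate) simp_all
    then show ?thesis using True by (simp add: W V q(1) n) (simp add: m prod_list_rotate)
  next
    case False
    then show ?thesis by (simp add: W V)
  qed
  show ?thesis
    unfolding Pi_D_def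
    by (intro D.jacobian_algebra_rescale[where \<phi> = "weight_D s"] keys ballI coeff weight_D_nonzero[OF assms])
qed

end
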